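(* Let $k$ be a field of characteristic different from $2$ with separable closure $\bar k$, and let $f\in k(x)$ be a rational function of degree $2$, with critical points $p_0,q_0\in\mathbb{P}^1(\bar k)$, whose postcritical orbit $P=\bigcup_{n\ge1}f^n(\{p_0,q_0\})\subset\mathbb{P}^1(\bar k)$ is infinite. Assume that $f^{r+1}(p_0)=f^{r+1}(q_0)$ for some $r\ge1$, and let $r\ge1$ be minimal with this property. Let $k\subset k'\subset\bar k$ be an intermediate field and $x'\in\mathbb{P}^1(k')\setminus P$. Let $T_{x'}$ be the regular rooted binary tree with set of vertices $\coprod_{n\ge0}f^{-n}(x')$ (where $f^{-n}(x')\subset\mathbb{P}^1(\bar k)$, and each vertex $x$ at level $n\ge1$ is joined to $f(x)$ at level $n-1$), identify $T_{x'}$ with $T$ in some way, and let $G_{x'}\subset W$ be the image of the homomorphism $\mathrm{Gal}(\bar k/k')\to W$ describing the action on $T_{x'}$. Then there exists $w\in W$ such that $$G_{x'}\subset w\,\tilde G(r)\,w^{-1}.$$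
   Context: Tree: $T$ is the regular rooted binary tree whose vertices are the finite words over $\{0,1\}$ (root = empty word; the children of $t$ are $t0,t1$). $W=\mathrm{Aut}(T)$ is the profinite group of automorphisms of $T$ fixing the root. Identifying the subtrees below the vertices $0$ and $1$ with $T$ gives $W=(W\times W)\rtimes\langle\sigma\rangle$, where $(u,v)$ acts by $u$ on the first and by $v$ on the second subtree, and $\sigma$ is the involution interchanging the two subtrees, so $\sigma(u,v)=(v,u)\sigma$. The groups $G(r)$ and $\tilde G(r)$: for an integer $r\ge1$, define elements $a_i$ ($i\ge1$) and $b_j$ ($1\le j\le r$) of $W$ as the unique elements satisfying the recursion relations $a_1=\sigma$; $a_{r+1}=(a_r,b_r)$; $a_i=(a_{i-1},1)$ for all $i>1$ with $i\ne r+1$; $b_1=(b_r,b_r^{-1})\sigma$; $b_j=(b_rb_{j-1}b_r^{-1},1)$ for all $1<j\le r$. (Such relations determine unique elements of $W$, level by level.) $G(r)$ is the closure in $W$ of the subgroup generated by all $a_i$ and $b_j$. Let $\tilde w\in W$ be the unique element with $\tilde w=(\tilde w,b_r\tilde w)$; it normalizes $G(r)$. $\tilde G(r)$ is the subgroup of $W$ generated by $G(r)$ and $\tilde w$. *)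

theory Defs
  imports
    "HOL-Analysis.Function_Topology"
    "HOL-Computational_Algebra.Polynomial"
    "HOL-Algebra.Generated_Groups"
begin

(* The separable closure of the ground field is the type 'a; the ground field and the
   intermediate fields are subsets of 'a. *)

definition is_subfield :: "'a::field set \<Rightarrow> bool" where
  "is_subfield K \<longleftrightarrow> 0 \<in> K \<and> 1 \<in> K \<and>
     (\<forall>x\<in>K. \<forall>y\<in>K. x + y \<in> K \<and> x * y \<in> K) \<and> (\<forall>x\<in>K. - x \<in> K \<and> inverse x \<in> K)"

definition polys_over :: "'a::field set \<Rightarrow> 'a poly set" where
  "polys_over K = {p. \<forall>i. coeff p i \<in> K}"

definition separable_poly :: "'a::field poly \<Rightarrow> bool" where
  "separable_poly p \<longleftrightarrow> coprime p (pderiv p)"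

definition separable_over :: "'a::field set \<Rightarrow> 'a \<Rightarrow> bool" where
  "separable_over K x \<longleftrightarrow> (\<exists>p\<in>polys_over K. separable_poly p \<and> poly p x = 0)"

(* The whole type is a separable closure of its subfield K. *)
definition separable_closure_of :: "'a::field set \<Rightarrow> bool" where
  "separable_closure_of K \<longleftrightarrow> is_subfield K \<and> (\<forall>x::'a. separable_over K x) \<and>
     (\<forall>p::'a poly. separable_poly p \<and> degree p > 0 \<longrightarrow> (\<exists>x. poly p x = 0))"

definition galois_group :: "'a::field set \<Rightarrow> ('a \<Rightarrow> 'a) set" where
  "galois_group K = {s. bij s \<and> (\<forall>x y. s (x + y) = s x + s y \<and> s (x * y) = s x * s y) \<and>
     (\<forall>x\<in>K. s x = x)}"

datatype 'a proj_line = Affine 'a | Infty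

definition proj_points :: "'a set \<Rightarrow> 'a proj_line set" where
  "proj_points K = insert Infty (Affine ` K)"

(* A rational function is given by numerator and denominator in lowest terms. *)

type_synonym 'a ratfun = "'a poly \<times> 'a poly"

definition ratfuns_over :: "'a::field set \<Rightarrow> 'a ratfun set" where
  "ratfuns_over K = {f. fst f \<in> polys_over K \<and> snd f \<in> polys_over K \<and> snd f \<noteq> 0 \<and>
     coprime (fst f) (snd f)}"

definition ratfun_degree :: "'a::field ratfun \<Rightarrow> nat" where
  "ratfun_degree f = max (degree (fst f)) (degree (snd f))"

(* The rational function t \<mapsto> f (1 / t), again in lowest terms: both polynomials are
   replaced by t ^ d times their value at 1 / t, where d is the degree of f. This is the
   expression of f in the coordinate t = 1 / x around infinity. *)
definition ratfun_at_infty :: "'a::field ratfun \<Rightarrow> 'a ratfun" where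
  "ratfun_at_infty f =
     (monom 1 (ratfun_degree f - degree (fst f)) * reflect_poly (fst f),
      monom 1 (ratfun_degree f - degree (snd f)) * reflect_poly (snd f))"

definition ratfun_eval_affine :: "'a::field ratfun \<Rightarrow> 'a \<Rightarrow> 'a proj_line" where
  "ratfun_eval_affine f x =
     (if poly (snd f) x = 0 then Infty else Affine (poly (fst f) x / poly (snd f) x))"

fun ratfun_eval :: "'a::field ratfun \<Rightarrow> 'a proj_line \<Rightarrow> 'a proj_line" where
  "ratfun_eval f (Affine x) = ratfun_eval_affine f x"
| "ratfun_eval f Infty = ratfun_eval_affine (ratfun_at_infty f) 0"

(* The differential of p / q at x is that of p / q in the affine coordinate of the target if
   q x \<noteq> 0, and that of q / p if q x = 0; up to a unit and sign, both have the
   numerator below. *)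
definition ratfun_critical_affine :: "'a::field ratfun \<Rightarrow> 'a \<Rightarrow> bool" where
  "ratfun_critical_affine f x \<longleftrightarrow>
     poly (pderiv (fst f) * snd f - fst f * pderiv (snd f)) x = 0"

fun ratfun_critical :: "'a::field ratfun \<Rightarrow> 'a proj_line \<Rightarrow> bool" where
  "ratfun_critical f (Affine x) \<longleftrightarrow> ratfun_critical_affine f x"
| "ratfun_critical f Infty \<longleftrightarrow> ratfun_critical_affine (ratfun_at_infty f) 0"

definition postcritical_orbit :: "'a::field ratfun \<Rightarrow> 'a proj_line set" where
  "postcritical_orbit f =
     (\<Union>n\<in>{1..}. (ratfun_eval f ^^ n) ` {z. ratfun_critical f z})"

definition rooted_tree_iso ::
  "'v set \<Rightarrow> ('v \<Rightarrow> 'v \<Rightarrow> bool) \<Rightarrow> 'v \<Rightarrow>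
   'w set \<Rightarrow> ('w \<Rightarrow> 'w \<Rightarrow> bool) \<Rightarrow> 'w \<Rightarrow> ('v \<Rightarrow> 'w) \<Rightarrow> bool" where
  "rooted_tree_iso V E v V' E' v' \<phi> \<longleftrightarrow>
     bij_betw \<phi> V V' \<and> \<phi> v = v' \<and> (\<forall>s\<in>V. \<forall>t\<in>V. E' (\<phi> s) (\<phi> t) \<longleftrightarrow> E s t)"

(* The letters 0 and 1 are False and True; the first letter of a word is the one next to the
   root. *)

type_synonym word = "bool list"

definition word_adj :: "word \<Rightarrow> word \<Rightarrow> bool" where
  "word_adj s t \<longleftrightarrow> (\<exists>c. t = s @ [c]) \<or> (\<exists>c. s = t @ [c])"

definition preimage_tree_vertices ::
  "'a::field ratfun \<Rightarrow> 'a proj_line \<Rightarrow> (nat \<times> 'a proj_line) set" where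
  "preimage_tree_vertices f x' = {(n, x). (ratfun_eval f ^^ n) x = x'}"

definition preimage_tree_adj ::
  "'a::field ratfun \<Rightarrow> nat \<times> 'a proj_line \<Rightarrow> nat \<times> 'a proj_line \<Rightarrow> bool" where
  "preimage_tree_adj f v w \<longleftrightarrow>
     fst v = Suc (fst w) \<and> ratfun_eval f (snd v) = snd w \<or>
     fst w = Suc (fst v) \<and> ratfun_eval f (snd w) = snd v"

definition tree_identification ::
  "'a::field ratfun \<Rightarrow> 'a proj_line \<Rightarrow> (word \<Rightarrow> nat \<times> 'a proj_line) \<Rightarrow> bool" where
  "tree_identification f x' \<phi> \<longleftrightarrow>
     rooted_tree_iso UNIV word_adj []
       (preimage_tree_vertices f x') (preimage_tree_adj f) (0, x') \<phi>"

definition galois_image :: "'a::field set \<Rightarrow> (word \<Rightarrow> nat \<times> 'a proj_line) \<Rightarrow> (word \<Rightarrow> word) set" where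
  "galois_image K \<phi> =
     (\<lambda>s t. inv_into UNIV \<phi> (map_prod id (map_proj_line s) (\<phi> t))) ` galois_group K"

definition W :: "(word \<Rightarrow> word) monoid" where
  "W = \<lparr>carrier = {g. rooted_tree_iso UNIV word_adj [] UNIV word_adj [] g},
        monoid.mult = (\<circ>), one = id\<rparr>"

(* A basis of neighbourhoods of g consists of the sets of all automorphisms that agree with g
   on a given finite set of vertices, which is the profinite topology. *)
definition W_topology :: "(word \<Rightarrow> word) topology" where
  "W_topology = subtopology (product_topology (\<lambda>_. discrete_topology UNIV) UNIV) (carrier W)"

fun tree_pair :: "(word \<Rightarrow> word) \<Rightarrow> (word \<Rightarrow> word) \<Rightarrow> word \<Rightarrow> word" where
  "tree_pair u v [] = []"
| "tree_pair u v (False # t) = False # u t"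
| "tree_pair u v (True # t) = True # v t"

fun tree_swap :: "word \<Rightarrow> word" where
  "tree_swap [] = []"
| "tree_swap (c # t) = (\<not> c) # t"

definition gen_relations ::
  "nat \<Rightarrow> (nat \<Rightarrow> word \<Rightarrow> word) \<Rightarrow> (nat \<Rightarrow> word \<Rightarrow> word) \<Rightarrow> bool" where
  "gen_relations r a b \<longleftrightarrow>
     (\<forall>i\<ge>1. a i \<in> carrier W) \<and> (\<forall>j\<in>{1..r}. b j \<in> carrier W) \<and>
     a 1 = tree_swap \<and>
     a (r + 1) = tree_pair (a r) (b r) \<and>
     (\<forall>i>1. i \<noteq> r + 1 \<longrightarrow> a i = tree_pair (a (i - 1)) \<one>\<^bsub>W\<^esub>) \<and>
     b 1 = tree_pair (b r) (inv\<^bsub>W\<^esub> (b r)) \<otimes>\<^bsub>W\<^esub> tree_swap \<and>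
     (\<forall>j\<in>{2..r}. b j = tree_pair (b r \<otimes>\<^bsub>W\<^esub> b (j - 1) \<otimes>\<^bsub>W\<^esub> inv\<^bsub>W\<^esub> (b r)) \<one>\<^bsub>W\<^esub>)"

(* For r \<ge> 1 the descriptions below are uniquely satisfiable: see gen_relations_unique,
   gen_relations_gen and w_tilde_unique, w_tilde_eq. *)

definition gen_a :: "nat \<Rightarrow> nat \<Rightarrow> word \<Rightarrow> word" where
  "gen_a r i = (THE g. \<exists>a b. gen_relations r a b \<and> g = a i)"

definition gen_b :: "nat \<Rightarrow> nat \<Rightarrow> word \<Rightarrow> word" where
  "gen_b r j = (THE g. \<exists>a b. gen_relations r a b \<and> g = b j)"

definition w_tilde :: "nat \<Rightarrow> word \<Rightarrow> word" where
  "w_tilde r = (THE w. w \<in> carrier W \<and> w = tree_pair w (gen_b r r \<otimes>\<^bsub>W\<^esub> w))"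

definition G :: "nat \<Rightarrow> (word \<Rightarrow> word) set" where
  "G r = W_topology closure_of generate W (gen_a r ` {1..} \<union> gen_b r ` {1..r})"

definition G_tilde :: "nat \<Rightarrow> (word \<Rightarrow> word) set" where
  "G_tilde r = generate W (G r \<union> {w_tilde r})"

lemma carrier_W_iff:
  "g \<in> carrier W \<longleftrightarrow> bij g \<and> g [] = [] \<and> (\<forall>s t. word_adj (g s) (g t) \<longleftrightarrow> word_adj s t)"
  by (simp add: W_def rooted_tree_iso_def)

lemma W_simps [simp]: "mult W = (\<circ>)" "one W = id"
  by (simp_all add: W_def)

lemma group_W: "group W"
proof (rule groupI)
  fix g h assume g: "g \<in> carrier W" and h: "h \<in> carrier W"
  then show "g \<otimes>\<^bsub>W\<^esub> h \<in> carrier W"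
    by (auto simp: carrier_W_iff intro: bij_comp)
next
  show "\<one>\<^bsub>W\<^esub> \<in> carrier W" by (simp add: carrier_W_iff)
next
  fix g assume g: "g \<in> carrier W"
  then have "bij g" by (simp add: carrier_W_iff)
  then have 1: "g (inv_into UNIV g t) = t" "inv_into UNIV g (g t) = t" for t
    by (simp_all add: bij_is_surj surj_f_inv_f bij_is_inj inv_f_f)
  have "inv_into UNIV g \<in> carrier W"
    using g 1 by (metis bij_imp_bij_inv carrier_W_iff)
  moreover have "inv_into UNIV g \<otimes>\<^bsub>W\<^esub> g = \<one>\<^bsub>W\<^esub>" using 1 by auto
  ultimately show "\<exists>h\<in>carrier W. h \<otimes>\<^bsub>W\<^esub> g = \<one>\<^bsub>W\<^esub>" by blast
qed (auto simp: o_assoc)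

interpretation W: group W by (rule group_W)

lemma carrier_W_snoc:
  assumes g: "g \<in> carrier W"
  shows "length (g t) = length t" and "\<exists>d. g (t @ [c]) = g t @ [d]"
proof -
  have g_Nil: "g [] = []" and adj: "word_adj (g t) (g (t @ [c]))" and i: "g s = g t \<Longrightarrow> s = t"
    for s t c
    using g by (auto simp: carrier_W_iff word_adj_def dest: bij_is_inj injD)
  have *: "length (g t) = length t \<and> (\<forall>c. \<exists>d. g (t @ [c]) = g t @ [d])" for t
  proof (induction t rule: rev_induct)
    case Nil
    have "\<exists>d. g [c] = [d]" for c
      using adj[of "[]" c] g_Nil by (auto simp: word_adj_def)
    then show ?case using g_Nil by simp
  next
    case (snoc e s)
    then obtain e' where e': "g (s @ [e]) = g s @ [e']" by blast
    have "\<exists>d. g ((s @ [e]) @ [c]) = g (s @ [e]) @ [d]" for c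
    proof (rule ccontr)
      assume n: "\<nexists>d. g ((s @ [e]) @ [c]) = g (s @ [e]) @ [d]"
      with adj[of "s @ [e]" c] obtain d where "g (s @ [e]) = g ((s @ [e]) @ [c]) @ [d]"
        unfolding word_adj_def by blast
      with e' have "g s = g ((s @ [e]) @ [c])" by simp
      from i[OF this] show False by simp
    qed
    with e' snoc show ?case by simp
  qed
  show "length (g t) = length t" "\<exists>d. g (t @ [c]) = g t @ [d]" using * by blast+
qed

lemma carrier_W_I:
  assumes l: "\<And>t. length (g t) = length t" and s: "\<And>t c. \<exists>d. g (t @ [c]) = g t @ [d]"
    and i: "inj g"
  shows "g \<in> carrier W"
proof -
  have Nil: "g [] = []" using l[of "[]"] by simp
  have b: "butlast (g t) = g (butlast t)" for t
  proof (cases t rule: rev_cases)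
    case Nil with \<open>g [] = []\<close> show ?thesis by simp
  next
    case (snoc u c)
    then show ?thesis using s[of u c] by auto
  qed
  have adj: "word_adj s t \<longleftrightarrow> (t \<noteq> [] \<and> butlast t = s) \<or> (s \<noteq> [] \<and> butlast s = t)" for s t
    by (cases s rule: rev_cases; cases t rule: rev_cases) (auto simp: word_adj_def)
  have n: "g t = [] \<longleftrightarrow> t = []" for t using l[of t] by (metis length_0_conv)
  have gi: "g s = g t \<longleftrightarrow> s = t" for s t using i by (rule inj_eq)
  have fin: "finite {t::word. length t = n}" for n
    using finite_lists_length_eq[of "UNIV::bool set" n] by simp
  have "g ` {t. length t = n} = {t. length t = n}" for n
    by (rule endo_inj_surj[OF fin]) (use l i in \<open>auto intro: inj_on_subset\<close>)
  then have "t \<in> g ` {u. length u = length t}" for t by blast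
  then have "surj g" by blast
  with i have "bij g" by (simp add: bij_def)
  moreover have "word_adj (g s) (g t) = word_adj s t" for s t
    unfolding adj b n gi ..
  ultimately show ?thesis using Nil by (simp add: carrier_W_iff)
qed

lemma carrier_W_inj: "g \<in> carrier W \<Longrightarrow> g s = g t \<Longrightarrow> s = t"
  by (meson bij_is_inj carrier_W_iff injD)

lemma tree_pair_in_W:
  assumes "u \<in> carrier W" "v \<in> carrier W"
  shows "tree_pair u v \<in> carrier W"
proof (rule carrier_W_I)
  note sn = carrier_W_snoc[OF assms(1)] carrier_W_snoc[OF assms(2)]
  have Nil: "u [] = []" "v [] = []" using assms by (auto simp: carrier_W_iff)
  show "length (tree_pair u v t) = length t" for t
    by (cases t; cases "hd t") (use sn in auto)
  show "\<exists>d. tree_pair u v (t @ [c]) = tree_pair u v t @ [d]" for t c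
  proof (cases t)
    case Nil' : Nil then show ?thesis using Nil by (cases c) auto
  next
    case (Cons e t') then show ?thesis using sn by (cases e) auto
  qed
  show "inj (tree_pair u v)"
  proof (rule injI)
    fix s t assume "tree_pair u v s = tree_pair u v t"
    then show "s = t"
      by (cases s; cases t; cases "hd s"; cases "hd t")
        (auto dest: carrier_W_inj[OF assms(1)] carrier_W_inj[OF assms(2)])
  qed
qed

lemma tree_swap_in_W: "tree_swap \<in> carrier W"
proof (rule carrier_W_I)
  show "length (tree_swap t) = length t" for t by (cases t) auto
  show "\<exists>d. tree_swap (t @ [c]) = tree_swap t @ [d]" for t c by (cases t) auto
  show "inj tree_swap" by (rule injI, case_tac x; case_tac y) auto
qed

definition agree :: "nat \<Rightarrow> ('i \<Rightarrow> word \<Rightarrow> word) \<Rightarrow> ('i \<Rightarrow> word \<Rightarrow> word) \<Rightarrow> bool" where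
  "agree n X Y \<longleftrightarrow> (\<forall>i t. length t \<le> n \<longrightarrow> X i t = Y i t)"

lemma contraction_unique:
  assumes F: "\<And>n X Y. (\<forall>i. X i \<in> carrier W) \<Longrightarrow> (\<forall>i. Y i \<in> carrier W) \<Longrightarrow>
      agree n X Y \<Longrightarrow> agree (Suc n) (F X) (F Y)"
    and X: "\<forall>i. X i \<in> carrier W" "F X = X" and Y: "\<forall>i. Y i \<in> carrier W" "F Y = Y"
  shows "X = Y"
proof -
  have "agree n X Y" for n
  proof (induction n)
    case 0 then show ?case using X Y by (auto simp: agree_def carrier_W_iff)
  next
    case (Suc n) then show ?case using F[OF X(1) Y(1) Suc] X(2) Y(2) by simp
  qed
  then have "X i t = Y i t" for i t unfolding agree_def by blast
  then show ?thesis by (intro ext)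
qed

lemma contraction_exists:
  fixes F :: "('i \<Rightarrow> word \<Rightarrow> word) \<Rightarrow> ('i \<Rightarrow> word \<Rightarrow> word)"
  assumes F: "\<And>n X Y. (\<forall>i. X i \<in> carrier W) \<Longrightarrow> (\<forall>i. Y i \<in> carrier W) \<Longrightarrow>
      agree n X Y \<Longrightarrow> agree (Suc n) (F X) (F Y)"
    and F_W: "\<And>X. (\<forall>i. X i \<in> carrier W) \<Longrightarrow> (\<forall>i. F X i \<in> carrier W)"
  shows "\<exists>X. (\<forall>i. X i \<in> carrier W) \<and> F X = X"
proof -
  define Z where "Z n = (F ^^ n) (\<lambda>_. id)" for n
  have Z_W: "\<forall>i. Z n i \<in> carrier W" for n
  proof (induction n)
    case 0 then show ?case using W.one_closed by (simp add: Z_def id_def)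
  next
    case (Suc n) then show ?case using F_W[OF Suc] by (simp add: Z_def)
  qed
  have ZS: "agree n (Z n) (Z (Suc n))" for n
  proof (induction n)
    case 0 then show ?case using Z_W by (auto simp: agree_def carrier_W_iff)
  next
    case (Suc n) then show ?case using F[OF Z_W Z_W Suc] by (simp add: Z_def)
  qed
  have Zm: "Z (length t + k) i t = Z (length t) i t" for t k i
  proof (induction k)
    case (Suc k)
    have "Z (length t + k) i t = Z (Suc (length t + k)) i t"
      using ZS[of "length t + k"] unfolding agree_def by simp
    with Suc show ?case by simp
  qed simp
  define X where "X i t = Z (length t) i t" for i t
  have XZ: "X i t = Z n i t" if "length t \<le> n" for i t n
    using that Zm[of t "n - length t" i] by (simp add: X_def)
  have X_W: "\<forall>i. X i \<in> carrier W"
  proof (intro allI carrier_W_I)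
    fix i
    show l: "length (X i t) = length t" for t
      unfolding X_def by (rule carrier_W_snoc(1)[OF Z_W[rule_format]])
    show "\<exists>d. X i (t @ [c]) = X i t @ [d]" for t c
      using carrier_W_snoc(2)[of "Z (Suc (length t)) i" t c] Z_W
      by (simp add: X_def[of _ "t @ [c]"] XZ[of t "Suc (length t)"])
    show "inj (X i)"
    proof (rule injI)
      fix s t assume e: "X i s = X i t"
      then have "length s = length t" using l by metis
      with e have "Z (length t) i s = Z (length t) i t" by (simp add: X_def)
      then show "s = t" by (rule carrier_W_inj[OF Z_W[rule_format]])
    qed
  qed
  have "agree n (F X) X" for n
  proof -
    have "agree n X (Z n)" unfolding agree_def using XZ by blast
    then have "agree (Suc n) (F X) (Z (Suc n))" using F[OF X_W Z_W] by (simp add: Z_def)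
    then have "F X i t = X i t" if "length t \<le> n" for i t
      using that XZ[of t "Suc n" i] by (simp add: agree_def)
    then show ?thesis by (simp add: agree_def)
  qed
  then have "F X i t = X i t" for i t unfolding agree_def by blast
  then have "F X = X" by (intro ext)
  with X_W show ?thesis by blast
qed

lemma inv_W_agree:
  assumes g: "g \<in> carrier W" and h: "h \<in> carrier W"
    and e: "\<And>t. length t \<le> n \<Longrightarrow> g t = h t" and t: "length t \<le> n"
  shows "(inv\<^bsub>W\<^esub> g) t = (inv\<^bsub>W\<^esub> h) t"
proof -
  have gi: "g ((inv\<^bsub>W\<^esub> g) t) = t" and hi: "h ((inv\<^bsub>W\<^esub> h) t) = t"
    using fun_cong[OF W.r_inv[OF g], of t] fun_cong[OF W.r_inv[OF h], of t] by simp_all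
  have "length ((inv\<^bsub>W\<^esub> h) t) \<le> n"
    using carrier_W_snoc(1)[OF W.inv_closed[OF h], of t] t by simp
  from e[OF this] gi hi have "g ((inv\<^bsub>W\<^esub> g) t) = g ((inv\<^bsub>W\<^esub> h) t)" by simp
  then show ?thesis by (rule carrier_W_inj[OF g])
qed

lemma tree_pair_agree:
  assumes "\<And>t. length t \<le> n \<Longrightarrow> u t = u' t" "\<And>t. length t \<le> n \<Longrightarrow> v t = v' t"
    "length t \<le> Suc n"
  shows "tree_pair u v t = tree_pair u' v' t"
proof (cases t)
  case (Cons c s)
  then show ?thesis using assms(1)[of s] assms(2)[of s] assms(3) by (cases c) simp_all
qed simp

(* The recursion as an operator on families indexed by Inl i for a_i and Inr j for b_j, set to
   the identity at the meaningless indices *)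
definition gen_step :: "nat \<Rightarrow> (nat + nat \<Rightarrow> word \<Rightarrow> word) \<Rightarrow> nat + nat \<Rightarrow> word \<Rightarrow> word" where
  "gen_step r X k = (case k of
     Inl i \<Rightarrow> if i = 0 then id else if i = 1 then tree_swap
       else if i = r + 1 then tree_pair (X (Inl r)) (X (Inr r))
       else tree_pair (X (Inl (i - 1))) id
   | Inr j \<Rightarrow> if j = 0 \<or> j > r then id
       else if j = 1 then tree_pair (X (Inr r)) (inv\<^bsub>W\<^esub> (X (Inr r))) \<circ> tree_swap
       else tree_pair (X (Inr r) \<circ> X (Inr (j - 1)) \<circ> inv\<^bsub>W\<^esub> (X (Inr r))) id)"

lemma length_tree_swap [simp]: "length (tree_swap t) = length t"
  using carrier_W_snoc(1)[OF tree_swap_in_W] .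

lemma comp_in_W: "g \<in> carrier W \<Longrightarrow> h \<in> carrier W \<Longrightarrow> g \<circ> h \<in> carrier W"
  using W.m_closed[of g h] by simp

lemma id_in_W: "id \<in> carrier W"
  using W.one_closed by simp

lemma gen_step_in_W:
  assumes X: "\<forall>i. X i \<in> carrier W"
  shows "\<forall>i. gen_step r X i \<in> carrier W"
proof
  fix k
  have i: "inv\<^bsub>W\<^esub> (X k) \<in> carrier W" for k using X by (blast intro: W.inv_closed)
  note c = tree_pair_in_W comp_in_W tree_swap_in_W id_in_W X[rule_format] i
  show "gen_step r X k \<in> carrier W"
  proof (cases k)
    case (Inl i)
    have "tree_pair (X (Inl r)) (X (Inr r)) \<in> carrier W"
      "tree_pair (X (Inl (i - 1))) id \<in> carrier W"
      by (intro c)+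
    with Inl c(3,4) show ?thesis by (simp add: gen_step_def)
  next
    case (Inr j)
    have "tree_pair (X (Inr r)) (inv\<^bsub>W\<^esub> (X (Inr r))) \<circ> tree_swap \<in> carrier W"
      "tree_pair (X (Inr r) \<circ> X (Inr (j - 1)) \<circ> inv\<^bsub>W\<^esub> (X (Inr r))) id \<in> carrier W"
      by (intro c)+
    with Inr c(4) show ?thesis by (simp add: gen_step_def)
  qed
qed

lemma gen_step_agree:
  assumes X: "\<forall>i. X i \<in> carrier W" and Y: "\<forall>i. Y i \<in> carrier W" and a: "agree n X Y"
  shows "agree (Suc n) (gen_step r X) (gen_step r Y)"
proof -
  have e: "X i t = Y i t" if "length t \<le> n" for i t
    using a that by (simp add: agree_def)
  have ie: "(inv\<^bsub>W\<^esub> (X i)) t = (inv\<^bsub>W\<^esub> (Y i)) t" if "length t \<le> n" for i t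
    by (rule inv_W_agree[OF X[rule_format] Y[rule_format] e that])
  have l: "length (Y i t) = length t" "length ((inv\<^bsub>W\<^esub> (Y i)) t) = length t" for i t
    by (rule carrier_W_snoc(1), use Y in \<open>blast intro: W.inv_closed\<close>)+
  have "gen_step r X k t = gen_step r Y k t" if t: "length t \<le> Suc n" for k t
  proof (cases k)
    case (Inl i)
    have "tree_pair (X (Inl r)) (X (Inr r)) t = tree_pair (Y (Inl r)) (Y (Inr r)) t"
      "tree_pair (X (Inl (i - 1))) id t = tree_pair (Y (Inl (i - 1))) id t"
      using t by (auto intro!: tree_pair_agree[where n = n] e)
    with Inl show ?thesis by (simp add: gen_step_def)
  next
    case (Inr j)
    have "tree_pair (X (Inr r)) (inv\<^bsub>W\<^esub> (X (Inr r))) (tree_swap t) =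
        tree_pair (Y (Inr r)) (inv\<^bsub>W\<^esub> (Y (Inr r))) (tree_swap t)"
      using t by (intro tree_pair_agree[where n = n] e ie) simp_all
    moreover have "tree_pair (X (Inr r) \<circ> X (Inr (j - 1)) \<circ> inv\<^bsub>W\<^esub> (X (Inr r))) id t =
        tree_pair (Y (Inr r) \<circ> Y (Inr (j - 1)) \<circ> inv\<^bsub>W\<^esub> (Y (Inr r))) id t"
      using t by (intro tree_pair_agree[where n = n]) (simp_all add: e ie l)
    ultimately show ?thesis using Inr by (simp add: gen_step_def)
  qed
  then show ?thesis by (simp add: agree_def)
qed

lemma gen_relationsD:
  assumes "gen_relations r a b"
  shows "i \<ge> 1 \<Longrightarrow> a i \<in> carrier W" "j \<in> {1..r} \<Longrightarrow> b j \<in> carrier W"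
    "a 1 = tree_swap" "a (r + 1) = tree_pair (a r) (b r)"
    "i > 1 \<Longrightarrow> i \<noteq> r + 1 \<Longrightarrow> a i = tree_pair (a (i - 1)) id"
    "b 1 = tree_pair (b r) (inv\<^bsub>W\<^esub> (b r)) \<circ> tree_swap"
    "j \<in> {2..r} \<Longrightarrow> b j = tree_pair (b r \<circ> b (j - 1) \<circ> inv\<^bsub>W\<^esub> (b r)) id"
  using assms unfolding gen_relations_def W_simps by blast+

lemma gen_relations_iff:
  assumes r: "r \<ge> 1"
  shows "gen_relations r a b \<longleftrightarrow>
    (\<exists>X. (\<forall>i. X i \<in> carrier W) \<and> gen_step r X = X \<and>
      (\<forall>i\<ge>1. a i = X (Inl i)) \<and> (\<forall>j\<in>{1..r}. b j = X (Inr j)))"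
    (is "_ \<longleftrightarrow> ?R")
proof
  assume g: "gen_relations r a b"
  note d = gen_relationsD[OF g]
  define X where "X = case_sum (\<lambda>i. if i = 0 then id else a i)
                                (\<lambda>j. if j = 0 \<or> j > r then id else b j)"
  have XI: "X (Inl 0) = id" "i \<noteq> 0 \<Longrightarrow> X (Inl i) = a i"
      "j = 0 \<or> j > r \<Longrightarrow> X (Inr j) = id" "j \<in> {1..r} \<Longrightarrow> X (Inr j) = b j" for i j
    by (auto simp: X_def)
  have Xr: "X (Inl r) = a r" "X (Inr r) = b r" using XI(2)[of r] XI(4)[of r] r by auto
  have "X k \<in> carrier W" for k
  proof (cases k)
    case (Inl i) then show ?thesis using XI(1,2) d(1)[of i] id_in_W by (cases "i = 0") simp_all
  next
    case (Inr j) then show ?thesis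
      using XI(3,4)[of j] d(2)[of j] id_in_W by (cases "j \<in> {1..r}") auto
  qed
  moreover have "gen_step r X (Inl i) = X (Inl i)" for i
  proof -
    consider "i = 0" | "i = 1" | "i = r + 1" | "i > 1" "i \<noteq> r + 1" by linarith
    then show ?thesis
    proof cases
      case 2 then show ?thesis using XI(2)[of 1] d(3) by (simp add: gen_step_def)
    next
      case 3 then show ?thesis using XI(2)[of "r + 1"] d(4) r Xr by (simp add: gen_step_def)
    next
      case 4 then show ?thesis using XI(2)[of i] XI(2)[of "i - 1"] d(5)[of i]
        by (simp add: gen_step_def)
    qed (simp add: gen_step_def XI(1))
  qed
  moreover have "gen_step r X (Inr j) = X (Inr j)" for j
  proof -
    consider "j = 0 \<or> j > r" | "j = 1" | "j \<in> {2..r}" by fastforce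
    then show ?thesis
    proof cases
      case 1 then show ?thesis using XI(3)[of j] by (auto simp add: gen_step_def)
    next
      case 2 then show ?thesis using XI(4)[of 1] d(6) r Xr by (simp add: gen_step_def)
    next
      case 3
      then have "j \<in> {1..r}" "j - 1 \<in> {1..r}" by auto
      with 3 show ?thesis using XI(4)[of j] XI(4)[of "j - 1"] d(7)[of j] Xr
        by (simp add: gen_step_def)
    qed
  qed
  ultimately have "(\<forall>i. X i \<in> carrier W) \<and> gen_step r X = X"
    by (metis ext sum.exhaust)
  moreover have "(\<forall>i\<ge>1. a i = X (Inl i)) \<and> (\<forall>j\<in>{1..r}. b j = X (Inr j))"
    using XI(2,4) by simp
  ultimately show ?R by blast
next
  assume ?R
  then obtain X where X: "\<forall>i. X i \<in> carrier W" "gen_step r X = X"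
    and a: "\<And>i. i \<ge> 1 \<Longrightarrow> a i = X (Inl i)" and b: "\<And>j. j \<in> {1..r} \<Longrightarrow> b j = X (Inr j)" by blast
  have X1: "X k = gen_step r X k" for k by (simp add: X(2))
  have ar: "a r = X (Inl r)" "b r = X (Inr r)" using a[of r] b[of r] r by auto
  have "a 1 = tree_swap"
    using a[of 1] X1[of "Inl 1"] by (simp add: gen_step_def)
  moreover have "a (r + 1) = tree_pair (a r) (b r)"
    unfolding ar using a[of "r + 1"] X1[of "Inl (r + 1)"] r by (simp add: gen_step_def)
  moreover have "a i = tree_pair (a (i - 1)) id" if "i > 1" "i \<noteq> r + 1" for i
    using a[of i] a[of "i - 1"] X1[of "Inl i"] that by (simp add: gen_step_def)
  moreover have "b 1 = tree_pair (b r) (inv\<^bsub>W\<^esub> (b r)) \<circ> tree_swap"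
    unfolding ar using b[of 1] X1[of "Inr 1"] r by (simp add: gen_step_def)
  moreover have "b j = tree_pair (b r \<circ> b (j - 1) \<circ> inv\<^bsub>W\<^esub> (b r)) id" if "j \<in> {2..r}" for j
  proof -
    from that have "j \<in> {1..r}" "j - 1 \<in> {1..r}" by auto
    with that show ?thesis
      unfolding ar using b[of j] b[of "j - 1"] X1[of "Inr j"] by (simp add: gen_step_def)
  qed
  moreover have "a i \<in> carrier W" if "i \<ge> 1" for i using X(1) a[OF that] by simp
  moreover have "b j \<in> carrier W" if "j \<in> {1..r}" for j using X(1) b[OF that] by simp
  ultimately show "gen_relations r a b"
    unfolding gen_relations_def W_simps by blast
qed

lemma gen_relations_exists:
  assumes r: "r \<ge> 1"
  shows "\<exists>a b. gen_relations r a b"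
proof -
  obtain X where X: "\<forall>i. X i \<in> carrier W" "gen_step r X = X"
    using contraction_exists[of "gen_step r", OF gen_step_agree gen_step_in_W] by blast
  then have "gen_relations r (\<lambda>i. X (Inl i)) (\<lambda>j. X (Inr j))"
    unfolding gen_relations_iff[OF r] by (intro exI[of _ X]) simp
  then show ?thesis by blast
qed

lemma gen_relations_unique:
  assumes r: "r \<ge> 1" and ab: "gen_relations r a b" and ab': "gen_relations r a' b'"
  shows "i \<ge> 1 \<Longrightarrow> a i = a' i" and "j \<in> {1..r} \<Longrightarrow> b j = b' j"
proof -
  from ab obtain X where X: "\<forall>i. X i \<in> carrier W" "gen_step r X = X"
    and 1: "\<forall>i\<ge>1. a i = X (Inl i)" "\<forall>j\<in>{1..r}. b j = X (Inr j)"
    unfolding gen_relations_iff[OF r] by blast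
  from ab' obtain Y where Y: "\<forall>i. Y i \<in> carrier W" "gen_step r Y = Y"
    and 2: "\<forall>i\<ge>1. a' i = Y (Inl i)" "\<forall>j\<in>{1..r}. b' j = Y (Inr j)"
    unfolding gen_relations_iff[OF r] by blast
  have "X = Y"
    by (rule contraction_unique[of "gen_step r", OF gen_step_agree X Y])
  with 1 2 show "i \<ge> 1 \<Longrightarrow> a i = a' i" and "j \<in> {1..r} \<Longrightarrow> b j = b' j" by simp_all
qed

lemma gen_relations_gen:
  assumes r: "r \<ge> 1"
  shows "gen_relations r (gen_a r) (gen_b r)"
proof -
  obtain a b where ab: "gen_relations r a b" using gen_relations_exists[OF r] by blast
  have "gen_a r i = a i" if "i \<ge> 1" for i
    unfolding gen_a_def
    by (rule the_equality) (use ab gen_relations_unique(1)[OF r _ ab that] in blast)+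
  moreover have "gen_b r j = b j" if "j \<in> {1..r}" for j
    unfolding gen_b_def
    by (rule the_equality) (use ab gen_relations_unique(2)[OF r _ ab that] in blast)+
  moreover obtain X where "\<forall>i. X i \<in> carrier W" "gen_step r X = X"
    "\<forall>i\<ge>1. a i = X (Inl i)" "\<forall>j\<in>{1..r}. b j = X (Inr j)"
    using ab unfolding gen_relations_iff[OF r] by blast
  ultimately show ?thesis
    unfolding gen_relations_iff[OF r] by (intro exI[of _ X]) simp
qed

lemma w_tilde_step_agree:
  assumes X: "\<forall>i. X i \<in> carrier W" and Y: "\<forall>i. Y i \<in> carrier W"
    and a: "agree n X Y"
  shows "agree (Suc n) (\<lambda>i. tree_pair (X i) (b \<circ> X i)) (\<lambda>i. tree_pair (Y i) (b \<circ> Y i))"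
proof -
  have e: "X i t = Y i t" if "length t \<le> n" for i t
    using a that by (simp add: agree_def)
  show ?thesis
    unfolding agree_def by (intro allI impI tree_pair_agree[where n = n]) (simp_all add: e)
qed

lemma w_tilde_unique:
  assumes b: "b \<in> carrier W"
    and w: "w \<in> carrier W" "w = tree_pair w (b \<otimes>\<^bsub>W\<^esub> w)"
    and w': "w' \<in> carrier W" "w' = tree_pair w' (b \<otimes>\<^bsub>W\<^esub> w')"
  shows "w = w'"
proof -
  let ?F = "\<lambda>X (i::unit). tree_pair (X i) (b \<circ> X i)"
  have F: "?F (\<lambda>_. u) = (\<lambda>_. u)" if "u = tree_pair u (b \<otimes>\<^bsub>W\<^esub> u)" for u
    using that[symmetric] by simp
  have "(\<lambda>_::unit. w) = (\<lambda>_. w')"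
    by (rule contraction_unique[of ?F, OF w_tilde_step_agree _ F[OF w(2)] _ F[OF w'(2)]])
      (simp_all only: w(1) w'(1) simp_thms)
  then show ?thesis by (rule fun_cong)
qed

lemma w_tilde_eq:
  assumes r: "r \<ge> 1"
  shows "w_tilde r \<in> carrier W" "w_tilde r = tree_pair (w_tilde r) (gen_b r r \<otimes>\<^bsub>W\<^esub> w_tilde r)"
proof -
  let ?P = "\<lambda>w. w \<in> carrier W \<and> w = tree_pair w (gen_b r r \<otimes>\<^bsub>W\<^esub> w)"
  let ?F = "\<lambda>X (i::unit). tree_pair (X i) (gen_b r r \<circ> X i)"
  have b: "gen_b r r \<in> carrier W"
    using gen_relationsD(2)[OF gen_relations_gen[OF r], of r] r by simp
  have F_W: "\<forall>i. ?F X i \<in> carrier W" if "\<forall>i. X i \<in> carrier W" for X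
    using that b by (blast intro: tree_pair_in_W comp_in_W)
  obtain X where X: "\<forall>i. X i \<in> carrier W" "?F X = X"
    using contraction_exists[of ?F, OF w_tilde_step_agree F_W] by blast
  have P: "?P (X ())"
    using X(1) fun_cong[OF X(2), of "()", symmetric] unfolding W_simps by blast
  have "?P (w_tilde r)"
    unfolding w_tilde_def
  proof (rule theI[of ?P, OF P])
    fix w assume "?P w"
    then show "w = X ()" using w_tilde_unique[OF b, of w "X ()"] P by blast
  qed
  then show "w_tilde r \<in> carrier W"
    "w_tilde r = tree_pair (w_tilde r) (gen_b r r \<otimes>\<^bsub>W\<^esub> w_tilde r)" by blast+
qed

end

(* Attach to g in W and a vertex t the sign of g at t (does g exchange the children below t?) and
   let P_m(g, t) be the product of the signs at the descendants of t at distance m. Then G(r)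
   contains (in fact equals) the group of all g with P_r(g, t) = 1 for every t: the group generated
   by the a_i and b_j contains (u, v) whenever u, v lie in it and P_(r-1)(u) = P_(r-1)(v) at the
   root, which gives density level by level. As P_r(w~, t) = -1 for all t, every g for which
   P_r(g, t) does not depend on t lies in G~(r).

   On the side of f, let u be a coordinate on the projective line with divisor p_0 - q_0. The two
   points of a fibre of f have opposite coordinates, and taking norms along f turns a function
   with divisor p - q into one with divisor f(p) - f(q). Hence the square of the product N(t) of
   the coordinates of the first children of the descendants of t at distance r is the value at t
   of a function with divisor f^(r+1)(p_0) - f^(r+1)(q_0) = 0, a constant. After relabelling the
   tree, N(t) itself is constant; since a Galois automorphism maps u to u or to 1/u, its
   signs P_r are then independent of t. *)

theory Submission
  imports Defs
begin

subsection \<open>Signs of tree automorphisms\<close>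

text \<open>The target is an arbitrary commutative monoid because the same product is taken of
  integer signs and of field-valued coordinates.\<close>

fun descendant_prod :: "nat \<Rightarrow> (word \<Rightarrow> 'b::comm_monoid_mult) \<Rightarrow> word \<Rightarrow> 'b" where
  "descendant_prod 0 F t = F t"
| "descendant_prod (Suc m) F t =
     descendant_prod m F (t @ [False]) * descendant_prod m F (t @ [True])"

lemma descendant_prod_mult:
  "descendant_prod m (\<lambda>t. F t * H t) t = descendant_prod m F t * descendant_prod m H t"
  by (induction m arbitrary: t) (simp_all add: mult_ac)

lemma descendant_prod_Cons:
  "descendant_prod m F (c # t) = descendant_prod m (\<lambda>t. F (c # t)) t"
  by (induction m arbitrary: t) simp_all

lemma descendant_prod_root:
  "descendant_prod (Suc m) F [] =
     descendant_prod m (\<lambda>t. F (False # t)) [] * descendant_prod m (\<lambda>t. F (True # t)) []"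
  by (simp add: descendant_prod_Cons)

lemma descendant_prod_one [simp]: "descendant_prod m (\<lambda>t. 1) t = 1"
  by (induction m arbitrary: t) simp_all

lemma descendant_prod_hom:
  assumes "\<And>x y. s (x * y) = s x * s y"
  shows "s (descendant_prod m F t) = descendant_prod m (\<lambda>t. s (F t)) t"
  by (induction m arbitrary: t) (simp_all add: assms)

lemma children_W:
  assumes g: "g \<in> carrier W"
  shows "g (t @ [False]) = g t @ [False] \<and> g (t @ [True]) = g t @ [True] \<or>
    g (t @ [False]) = g t @ [True] \<and> g (t @ [True]) = g t @ [False]"
proof -
  obtain d where "g (t @ [False]) = g t @ [d]" using carrier_W_snoc(2)[OF g] by blast
  moreover obtain e where "g (t @ [True]) = g t @ [e]" using carrier_W_snoc(2)[OF g] by blast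
  moreover have "g (t @ [False]) \<noteq> g (t @ [True])" using carrier_W_inj[OF g] by blast
  ultimately show ?thesis by (cases d; cases e) auto
qed

text \<open>An automorphism carries the descendants of t at distance m bijectively to those of g t,
  so it only permutes the factors.\<close>

lemma descendant_prod_comp:
  assumes "g \<in> carrier W"
  shows "descendant_prod m (\<lambda>t. F (g t)) t = descendant_prod m F (g t)"
proof (induction m arbitrary: t)
  case (Suc m)
  then show ?case using children_W[OF assms, of t] by (auto simp: mult.commute)
qed simp

definition node_sign :: "(word \<Rightarrow> word) \<Rightarrow> word \<Rightarrow> int" where
  "node_sign g t = (if g (t @ [False]) = g t @ [False] then 1 else -1)"

definition level_sign :: "nat \<Rightarrow> (word \<Rightarrow> word) \<Rightarrow> word \<Rightarrow> int" where
  "level_sign m g = descendant_prod m (node_sign g)"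

lemma node_sign_comp:
  assumes "g \<in> carrier W" "h \<in> carrier W"
  shows "node_sign (g \<circ> h) t = node_sign g (h t) * node_sign h t"
  using children_W[OF assms(1), of "h t"] children_W[OF assms(2), of t]
  by (auto simp: node_sign_def)

text \<open>Whether g h exchanges the children of a vertex is decided by h there and by g at its
  image; as h permutes descendants, this cocycle rule survives taking products. At the root, which W
  fixes, it becomes multiplicativity.\<close>

lemma level_sign_comp:
  assumes "g \<in> carrier W" "h \<in> carrier W"
  shows "level_sign m (g \<circ> h) t = level_sign m g (h t) * level_sign m h t"
  unfolding level_sign_def node_sign_comp[OF assms, abs_def] descendant_prod_mult
    descendant_prod_comp[OF assms(2)] ..

lemma W_Nil [simp]: "g \<in> carrier W \<Longrightarrow> g [] = []"
  by (simp add: carrier_W_iff)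

lemma level_sign_comp_root:
  assumes "g \<in> carrier W" "h \<in> carrier W"
  shows "level_sign m (g \<circ> h) [] = level_sign m g [] * level_sign m h []"
  using level_sign_comp[OF assms] assms by simp

lemma level_sign_pm: "level_sign m g t = 1 \<or> level_sign m g t = -1"
  unfolding level_sign_def
proof (induction m arbitrary: t)
  case (Suc m)
  show ?case using Suc[of "t @ [False]"] Suc[of "t @ [True]"] by auto
qed (auto simp: node_sign_def)

lemma level_sign_square [simp]: "level_sign m g t * level_sign m g t = 1"
  using level_sign_pm[of m g t] by auto

lemma level_sign_id [simp]: "level_sign m id t = 1"
  unfolding level_sign_def by (simp add: node_sign_def[abs_def])

lemma W_inv_apply:
  assumes "g \<in> carrier W"
  shows "g ((inv\<^bsub>W\<^esub> g) t) = t" "(inv\<^bsub>W\<^esub> g) (g t) = t"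
  using fun_cong[OF W.r_inv[OF assms], of t] fun_cong[OF W.l_inv[OF assms], of t] by simp_all

lemma level_sign_inv:
  assumes "g \<in> carrier W"
  shows "level_sign m (inv\<^bsub>W\<^esub> g) t = level_sign m g ((inv\<^bsub>W\<^esub> g) t)"
proof -
  have "level_sign m g ((inv\<^bsub>W\<^esub> g) t) * level_sign m (inv\<^bsub>W\<^esub> g) t = 1"
    using level_sign_comp[OF assms W.inv_closed[OF assms], of m t] W.r_inv[OF assms] by simp
  then show ?thesis
    using level_sign_pm[of m g "(inv\<^bsub>W\<^esub> g) t"] by auto
qed

lemma level_sign_inv_root:
  "g \<in> carrier W \<Longrightarrow> level_sign m (inv\<^bsub>W\<^esub> g) [] = level_sign m g []"
  by (simp add: level_sign_inv)

section \<open>Pairs, the swap and the decomposition of W\<close>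

lemma level_sign_tree_pair:
  assumes "u \<in> carrier W" "v \<in> carrier W"
  shows "level_sign m (tree_pair u v) (False # t) = level_sign m u t"
    "level_sign m (tree_pair u v) (True # t) = level_sign m v t"
    "level_sign 0 (tree_pair u v) [] = 1"
    "level_sign (Suc m) (tree_pair u v) [] = level_sign m u [] * level_sign m v []"
proof -
  have s: "(\<lambda>t. node_sign (tree_pair u v) (False # t)) = node_sign u"
    "(\<lambda>t. node_sign (tree_pair u v) (True # t)) = node_sign v"
    by (simp_all add: node_sign_def fun_eq_iff)
  show "level_sign m (tree_pair u v) (False # t) = level_sign m u t"
    "level_sign m (tree_pair u v) (True # t) = level_sign m v t"
    "level_sign (Suc m) (tree_pair u v) [] = level_sign m u [] * level_sign m v []"
    unfolding level_sign_def descendant_prod_root descendant_prod_Cons s by simp_all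
  show "level_sign 0 (tree_pair u v) [] = 1"
    using assms by (simp add: level_sign_def node_sign_def)
qed

lemma level_sign_tree_swap:
  "level_sign m tree_swap (c # t) = 1" "level_sign 0 tree_swap [] = -1"
  "level_sign (Suc m) tree_swap [] = 1"
proof -
  have s: "(\<lambda>t. node_sign tree_swap (c # t)) = (\<lambda>_. 1)" for c
    by (simp add: node_sign_def fun_eq_iff)
  show "level_sign m tree_swap (c # t) = 1" "level_sign (Suc m) tree_swap [] = 1"
    unfolding level_sign_def descendant_prod_root descendant_prod_Cons s by simp_all
  show "level_sign 0 tree_swap [] = -1"
    by (simp add: level_sign_def node_sign_def)
qed

lemma tree_pair_comp: "tree_pair u v \<circ> tree_pair u' v' = tree_pair (u \<circ> u') (v \<circ> v')"
proof
  fix t show "(tree_pair u v \<circ> tree_pair u' v') t = tree_pair (u \<circ> u') (v \<circ> v') t"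
    by (cases t; cases "hd t") auto
qed

lemma tree_swap_pair: "tree_swap \<circ> tree_pair u v = tree_pair v u \<circ> tree_swap"
proof
  fix t show "(tree_swap \<circ> tree_pair u v) t = (tree_pair v u \<circ> tree_swap) t"
    by (cases t; cases "hd t") auto
qed

lemma tree_swap_swap [simp]: "tree_swap \<circ> tree_swap = id"
proof
  fix t show "(tree_swap \<circ> tree_swap) t = id t" by (cases t) auto
qed

lemma tree_pair_id [simp]: "tree_pair id id = id"
proof
  fix t show "tree_pair id id t = id t" by (cases t; cases "hd t") auto
qed

lemma inv_tree_pair:
  assumes "u \<in> carrier W" "v \<in> carrier W"
  shows "inv\<^bsub>W\<^esub> (tree_pair u v) = tree_pair (inv\<^bsub>W\<^esub> u) (inv\<^bsub>W\<^esub> v)"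
proof (rule W.inv_equality)
  show "tree_pair (inv\<^bsub>W\<^esub> u) (inv\<^bsub>W\<^esub> v) \<otimes>\<^bsub>W\<^esub> tree_pair u v = \<one>\<^bsub>W\<^esub>"
    using W.l_inv[OF assms(1)] W.l_inv[OF assms(2)] by (simp add: tree_pair_comp)
qed (use assms in \<open>auto intro: tree_pair_in_W\<close>)

text \<open>Automorphisms respect prefixes, so g carries the subtree below c to the subtree below d;
  deleting the first letters leaves the section u.\<close>

lemma W_section:
  assumes g: "g \<in> carrier W" and c: "g [c] = [d]"
  shows "\<exists>u\<in>carrier W. \<forall>t. g (c # t) = d # u t"
proof -
  have hd: "\<exists>v. g (c # t) = d # v \<and> length v = length t" for t
  proof (induction t rule: rev_induct)
    case (snoc e t)
    then show ?case using carrier_W_snoc(2)[OF g, of "c # t" e] by auto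
  qed (use c in auto)
  define u where "u t = tl (g (c # t))" for t
  have gu: "g (c # t) = d # u t" for t using hd[of t] by (auto simp: u_def)
  have "u \<in> carrier W"
  proof (rule carrier_W_I)
    show "length (u t) = length t" for t using hd[of t] gu[of t] by auto
    show "\<exists>e'. u (t @ [e]) = u t @ [e']" for t e
      using carrier_W_snoc(2)[OF g, of "c # t" e] gu[of t] gu[of "t @ [e]"] by auto
    show "inj u"
    proof (rule injI)
      fix s t assume "u s = u t"
      then have "g (c # s) = g (c # t)" using gu by metis
      then show "s = t" using carrier_W_inj[OF g] by blast
    qed
  qed
  with gu show ?thesis by blast
qed

text \<open>An automorphism that keeps both subtrees is the pair of its sections; one that exchanges
  them becomes of this kind after composing with the swap.\<close>

lemma W_cases:
  assumes g: "g \<in> carrier W"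
  obtains u v where "u \<in> carrier W" "v \<in> carrier W" "g = tree_pair u v"
  | u v where "u \<in> carrier W" "v \<in> carrier W" "g = tree_pair u v \<circ> tree_swap"
proof -
  have *: "\<exists>u\<in>carrier W. \<exists>v\<in>carrier W. g = tree_pair u v"
    if g: "g \<in> carrier W" "g [False] = [False]" "g [True] = [True]" for g
  proof -
    obtain u v where uv: "u \<in> carrier W" "v \<in> carrier W"
      "g (False # t) = False # u t" "g (True # t) = True # v t" for t
      using W_section[OF g(1,2)] W_section[OF g(1,3)] by blast
    have "g t = tree_pair u v t" for t using g(1) uv by (cases t; cases "hd t") auto
    with uv show ?thesis by blast
  qed
  show thesis
  proof (cases "g [False] = [False]")
    case True
    then show thesis using *[OF g] children_W[OF g, of "[]"] g that(1) by auto
  next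
    case False
    then have "g [False] = [True]" "g [True] = [False]"
      using children_W[OF g, of "[]"] g by auto
    then obtain u v where uv: "u \<in> carrier W" "v \<in> carrier W" "g \<circ> tree_swap = tree_pair u v"
      using *[OF comp_in_W[OF g tree_swap_in_W]] by auto
    have "g = (g \<circ> tree_swap) \<circ> tree_swap" unfolding comp_assoc by simp
    with uv(3) have "g = tree_pair u v \<circ> tree_swap" by simp
    with uv(1,2) show thesis using that(2) by blast
  qed
qed

text \<open>A basic open set of the product topology constrains the values at finitely many vertices
  only, and these have bounded length.\<close>

lemma W_closure_ofI:
  assumes g: "g \<in> carrier W"
    and H: "\<And>n. \<exists>h\<in>H. h \<in> carrier W \<and> (\<forall>t. length t \<le> n \<longrightarrow> h t = g t)"
  shows "g \<in> W_topology closure_of H"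
proof -
  have "\<exists>h. h \<in> H \<and> h \<in> T" if T: "openin W_topology T" "g \<in> T" for T
  proof -
    obtain U where U: "openin (product_topology (\<lambda>_. discrete_topology UNIV) UNIV) U"
      and TU: "T = U \<inter> carrier W"
      using T(1) unfolding W_topology_def openin_subtopology by blast
    have "g \<in> U" using T(2) TU by blast
    then obtain X where X: "finite {t. X t \<noteq> (UNIV::word set)}" "g \<in> Pi\<^sub>E UNIV X"
      "Pi\<^sub>E UNIV X \<subseteq> U"
      using U unfolding openin_product_topology_alt by auto
    obtain n where n: "\<And>t. X t \<noteq> UNIV \<Longrightarrow> length t \<le> n"
      using finite_nat_set_iff_bounded_le[of "length ` {t. X t \<noteq> UNIV}"] X(1) by auto
    obtain h where h: "h \<in> H" "h \<in> carrier W" "\<And>t. length t \<le> n \<Longrightarrow> h t = g t"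
      using H[of n] by blast
    have "h t \<in> X t" for t
      using X(2) h(3)[of t] n[of t] by (cases "X t = UNIV") (auto simp: PiE_iff)
    then have "h \<in> U" using X(3) by (auto simp: PiE_iff)
    with h TU show ?thesis by blast
  qed
  moreover have "topspace W_topology = carrier W"
    unfolding W_topology_def by simp
  ultimately show ?thesis using g unfolding in_closure_of by blast
qed

subsection \<open>The groups generated by the recursively defined elements\<close>

locale generator_system =
  fixes r :: nat
  assumes r: "r \<ge> 1"
begin

abbreviation "gens \<equiv> gen_a r ` {1..} \<union> gen_b r ` {1..r}"
abbreviation "\<Gamma> \<equiv> generate W gens"

text \<open>Facts 1 and 2 give membership in W, facts 3 to 5 the recursion for a_1, a_(r+1) and the
  other a_i, facts 6 and 7 that for b_1 and the other b_j.\<close>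

lemmas gen = gen_relationsD[OF gen_relations_gen[OF r]]

lemma gens_in_W: "gens \<subseteq> carrier W"
  using gen(1,2) by auto

lemma subgroup_Gamma: "subgroup \<Gamma> W"
  using W.generate_is_subgroup[OF gens_in_W] .

lemma Gamma_in_W: "h \<in> \<Gamma> \<Longrightarrow> h \<in> carrier W"
  using W.generate_in_carrier[OF gens_in_W] .

lemma Gamma_comp: "g \<in> \<Gamma> \<Longrightarrow> h \<in> \<Gamma> \<Longrightarrow> g \<circ> h \<in> \<Gamma>"
  using subgroup.m_closed[OF subgroup_Gamma] by simp

lemma Gamma_inv: "g \<in> \<Gamma> \<Longrightarrow> inv\<^bsub>W\<^esub> g \<in> \<Gamma>"
  using subgroup.m_inv_closed[OF subgroup_Gamma] .

lemma Gamma_id: "id \<in> \<Gamma>"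
  using subgroup.one_closed[OF subgroup_Gamma] by simp

lemma gen_a_in_Gamma: "i \<ge> 1 \<Longrightarrow> gen_a r i \<in> \<Gamma>"
  by (rule generate.incl) auto

lemma gen_b_in_Gamma: "j \<in> {1..r} \<Longrightarrow> gen_b r j \<in> \<Gamma>"
  by (rule generate.incl) auto

lemma gen_b_r: "gen_b r r \<in> \<Gamma>" "gen_b r r \<in> carrier W" "inv\<^bsub>W\<^esub> (gen_b r r) \<in> carrier W"
  using gen_b_in_Gamma[of r] gen(2)[of r] r by auto

lemma gen_a_r: "gen_a r r \<in> \<Gamma>" "gen_a r r \<in> carrier W"
  using gen_a_in_Gamma[of r] gen(1)[of r] r by auto

lemma swap_in_Gamma: "tree_swap \<in> \<Gamma>"
  using gen_a_in_Gamma[of 1] gen(3) by simp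

section \<open>Signs of the generators\<close>

text \<open>Only b_1 exchanges the children of the root, and its sections b_r and b_r^-1 contribute
  equal signs that cancel. For j > 1 the only nontrivial section is a conjugate of b_(j-1), which
  shifts the level by one.\<close>

lemma level_sign_gen_b_root:
  "j \<in> {1..r} \<Longrightarrow> level_sign m (gen_b r j) [] = (if m = j - 1 then -1 else 1)"
proof (induction m arbitrary: j)
  case 0
  show "level_sign 0 (gen_b r j) [] = (if 0 = j - 1 then -1 else 1)"
  proof (cases "j = 1")
    case True
    then show ?thesis
      unfolding True gen(6) level_sign_comp_root[OF tree_pair_in_W[OF gen_b_r(2,3)] tree_swap_in_W]
      by (simp add: level_sign_tree_pair gen_b_r level_sign_tree_swap)
  next
    case False
    then have "j \<in> {2..r}" "j - 1 \<in> {1..r}" using 0 by auto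
    then show ?thesis
      by (subst gen(7)) (simp_all add: level_sign_tree_pair comp_in_W gen_b_r gen(2) id_in_W)
  qed
next
  case (Suc m)
  show "level_sign (Suc m) (gen_b r j) [] = (if Suc m = j - 1 then -1 else 1)"
  proof (cases "j = 1")
    case True
    then show ?thesis
      unfolding True gen(6) by (simp add: level_sign_comp_root tree_pair_in_W gen_b_r tree_swap_in_W
          level_sign_tree_pair level_sign_tree_swap level_sign_inv_root)
  next
    case False
    then have j: "j \<in> {2..r}" "j - 1 \<in> {1..r}" using Suc.prems by auto
    have "level_sign (Suc m) (gen_b r j) [] = level_sign m (gen_b r (j - 1)) []"
      by (subst gen(7)[OF j(1)]) (use j in \<open>simp add: level_sign_tree_pair comp_in_W gen_b_r gen(2)
          id_in_W level_sign_comp_root level_sign_inv_root\<close>)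
    then show ?thesis using Suc.IH[OF j(2)] j(1) by auto
  qed
qed

text \<open>The recursion shifts levels by one until a_(r+1), whose sections a_r and b_r have the
  same root signs, so that these cancel. From there on all root signs are 1.\<close>

lemma level_sign_gen_a_root:
  "i \<ge> 1 \<Longrightarrow> level_sign m (gen_a r i) [] = (if m = i - 1 \<and> i \<le> r then -1 else 1)"
proof (induction m arbitrary: i)
  case 0
  consider "i = 1" | "i = r + 1" | "i > 1" "i \<noteq> r + 1" using 0 by linarith
  then show "level_sign 0 (gen_a r i) [] = (if 0 = i - 1 \<and> i \<le> r then -1 else 1)"
  proof cases
    case 1 then show ?thesis using r by (simp add: gen(3)[simplified] level_sign_tree_swap)
  next
    case 2 then show ?thesis
      unfolding 2 gen(4) by (simp add: level_sign_tree_pair gen_a_r gen_b_r)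
  next
    case 3 then show ?thesis
      by (subst gen(5)) (simp_all add: level_sign_tree_pair gen(1) id_in_W)
  qed
next
  case (Suc m)
  consider "i = 1" | "i = r + 1" | "i > 1" "i \<noteq> r + 1" using Suc.prems by linarith
  then show "level_sign (Suc m) (gen_a r i) [] = (if Suc m = i - 1 \<and> i \<le> r then -1 else 1)"
  proof cases
    case 1 then show ?thesis by (simp add: gen(3)[simplified] level_sign_tree_swap)
  next
    case 2
    have "level_sign m (gen_a r r) [] = level_sign m (gen_b r r) []"
      using Suc.IH[of r] level_sign_gen_b_root[of r m] r by auto
    then show ?thesis unfolding 2 gen(4) by (simp add: level_sign_tree_pair gen_a_r gen_b_r)
  next
    case 3
    then have "level_sign (Suc m) (gen_a r i) [] = level_sign m (gen_a r (i - 1)) []"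
      by (subst gen(5)) (simp_all add: level_sign_tree_pair gen(1) id_in_W)
    then show ?thesis using Suc.IH[of "i - 1"] 3 by auto
  qed
qed

text \<open>At the root, r differs from the one level j - 1 with sign -1. Below the root the
  nontrivial sections are b_r, its inverse or a conjugate of b_(j-1), and the cocycle rule together
  with preservation of length reduces to shorter vertices.\<close>

lemma level_sign_gen_b:
  "j \<in> {1..r} \<Longrightarrow> level_sign r (gen_b r j) t = 1"
proof (induction "length t" arbitrary: t j)
  case 0
  then show ?case using level_sign_gen_b_root[of j r] by auto
next
  case (Suc n)
  then obtain c s where t: "t = c # s" "length s = n" by (cases t) auto
  have IH: "level_sign r (gen_b r i) s = 1" if "i \<in> {1..r}" "length s = n" for i s
    using Suc.hyps(1)[of s i] that by blast
  have inv: "level_sign r (inv\<^bsub>W\<^esub> (gen_b r r)) s = 1"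
    if "length s = n" for s
    using that IH[of r] r by (simp add: level_sign_inv gen_b_r carrier_W_snoc(1))
  have l: "length ((inv\<^bsub>W\<^esub> (gen_b r r)) s) = n"
    "i \<in> {1..r} \<Longrightarrow> length (gen_b r i ((inv\<^bsub>W\<^esub> (gen_b r r)) s)) = n" for i
    using t gen_b_r gen(2)[of i] by (simp_all add: carrier_W_snoc(1))
  show ?case
  proof (cases "j = 1")
    case True
    have "level_sign r (tree_pair (gen_b r r) (inv\<^bsub>W\<^esub> (gen_b r r))) (d # s) = 1" for d
      using IH[of r s] inv[of s] t r by (cases d) (simp_all add: level_sign_tree_pair gen_b_r)
    then show ?thesis
      unfolding True gen(6) t by (simp add: level_sign_comp tree_pair_in_W gen_b_r tree_swap_in_W
          level_sign_tree_swap)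
  next
    case False
    then have j: "j \<in> {2..r}" "j - 1 \<in> {1..r}" using Suc.prems by auto
    have "level_sign r (gen_b r r \<circ> gen_b r (j - 1) \<circ> inv\<^bsub>W\<^esub> (gen_b r r)) s = 1"
      using j r l(1) l(2)[OF j(2)] t(2) by (simp add: level_sign_comp comp_in_W gen_b_r gen(2) IH inv)
    then show ?thesis
      unfolding t gen(7)[OF j(1)]
      using j by (cases c) (simp_all add: level_sign_tree_pair comp_in_W gen_b_r gen(2) id_in_W)
  qed
qed

section \<open>Pairs that lie in the group generated by the a_i and b_j\<close>

lemma gen_a_involution: "1 \<le> i \<Longrightarrow> i \<le> r \<Longrightarrow> gen_a r i \<circ> gen_a r i = id"
proof (induction i rule: dec_induct)
  case base
  then show ?case using gen(3) by simp
next
  case (step i)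
  have "gen_a r (Suc i) = tree_pair (gen_a r i) id"
    using gen(5)[of "Suc i"] step.hyps step.prems by simp
  moreover have "gen_a r i \<circ> gen_a r i = id" using step.IH step.prems by linarith
  ultimately show "gen_a r (Suc i) \<circ> gen_a r (Suc i) = id"
    by (simp only: tree_pair_comp comp_id tree_pair_id)
qed

text \<open>These are the factors by which the first coordinate of a pair in \<open>\<Gamma>\<close>
  can be multiplied freely without leaving \<open>\<Gamma>\<close>.\<close>

definition pair_kernel :: "(word \<Rightarrow> word) set" where
  "pair_kernel = {u \<in> \<Gamma>. tree_pair u id \<in> \<Gamma>}"

lemma pair_kernelD: "u \<in> pair_kernel \<Longrightarrow> u \<in> \<Gamma>" "u \<in> pair_kernel \<Longrightarrow> tree_pair u id \<in> \<Gamma>"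
  by (simp_all add: pair_kernel_def)

lemma pair_kernel_comp: "u \<in> pair_kernel \<Longrightarrow> v \<in> pair_kernel \<Longrightarrow> u \<circ> v \<in> pair_kernel"
  unfolding pair_kernel_def
  using Gamma_comp[of u v] Gamma_comp[of "tree_pair u id" "tree_pair v id"] by (simp add: tree_pair_comp)

lemma pair_kernel_inv: "u \<in> pair_kernel \<Longrightarrow> inv\<^bsub>W\<^esub> u \<in> pair_kernel"
  unfolding pair_kernel_def
  using Gamma_inv[of u] Gamma_inv[of "tree_pair u id"] inv_tree_pair[OF Gamma_in_W id_in_W, of u]
    W.inv_one by simp

lemma tree_pair_flip: "tree_pair u v \<in> \<Gamma> \<Longrightarrow> tree_pair v u \<in> \<Gamma>"
  using Gamma_comp[OF Gamma_comp[OF swap_in_Gamma, of "tree_pair u v"] swap_in_Gamma]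
  unfolding tree_swap_pair comp_assoc by simp

lemma tree_pair_gen_b_inv: "tree_pair (gen_b r r) (inv\<^bsub>W\<^esub> (gen_b r r)) \<in> \<Gamma>"
proof -
  have "tree_pair (gen_b r r) (inv\<^bsub>W\<^esub> (gen_b r r)) = gen_b r 1 \<circ> tree_swap"
    unfolding gen(6) comp_assoc by simp
  then show ?thesis
    using Gamma_comp[OF gen_b_in_Gamma swap_in_Gamma, of 1] r by auto
qed

lemma inv_comp_cancel:
  assumes "g \<in> carrier W"
  shows "inv\<^bsub>W\<^esub> g \<circ> g = id" "g \<circ> inv\<^bsub>W\<^esub> g = id"
    "inv\<^bsub>W\<^esub> g \<circ> (g \<circ> u) = u" "g \<circ> (inv\<^bsub>W\<^esub> g \<circ> u) = u"
  using W_inv_apply[OF assms] by (simp_all add: fun_eq_iff)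

lemma tree_pair_conj_gen_b:
  assumes "j \<in> {1..r}" "j \<noteq> r"
  shows "tree_pair (gen_b r r \<circ> gen_b r j \<circ> inv\<^bsub>W\<^esub> (gen_b r r)) id \<in> \<Gamma>"
  using gen(7)[of "Suc j"] gen_b_in_Gamma[of "Suc j"] assms by auto

text \<open>The pairs are a_(i+1) for a_i, b_1 a_1 = (b_r, b_r^-1) for b_r, and for the other b_j
  the element b_(j+1) = (b_r b_j b_r^-1, 1) conjugated back by (b_r, b_r^-1).\<close>

lemma gen_lift:
  assumes "s \<in> gens"
  shows "\<exists>v\<in>\<Gamma>. tree_pair s v \<in> \<Gamma>"
proof -
  have "\<exists>v\<in>\<Gamma>. tree_pair (gen_a r i) v \<in> \<Gamma>" if "i \<ge> 1" for i
  proof (cases "i = r")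
    case True
    then show ?thesis using gen(4) gen_a_in_Gamma[of "r + 1"] gen_b_r(1) by (intro bexI[of _ "gen_b r r"]) simp_all
  next
    case False
    then show ?thesis using gen(5)[of "i + 1"] gen_a_in_Gamma[of "i + 1"] Gamma_id that
      by (intro bexI[of _ id]) simp_all
  qed
  moreover have "\<exists>v\<in>\<Gamma>. tree_pair (gen_b r j) v \<in> \<Gamma>" if j: "j \<in> {1..r}" for j
  proof (cases "j = r")
    case True
    then show ?thesis using tree_pair_gen_b_inv Gamma_inv[OF gen_b_r(1)] by blast
  next
    case False
    let ?b = "gen_b r r"
    have "inv\<^bsub>W\<^esub> (tree_pair ?b (inv\<^bsub>W\<^esub> ?b)) \<circ> tree_pair (?b \<circ> gen_b r j \<circ> inv\<^bsub>W\<^esub> ?b) id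
        \<circ> tree_pair ?b (inv\<^bsub>W\<^esub> ?b) = tree_pair (gen_b r j) id"
      unfolding inv_tree_pair[OF gen_b_r(2,3)] W.inv_inv[OF gen_b_r(2)] tree_pair_comp comp_assoc
        inv_comp_cancel[OF gen_b_r(2)] comp_id id_comp ..
    then show ?thesis
      using Gamma_comp[OF Gamma_comp[OF Gamma_inv[OF tree_pair_gen_b_inv]
          tree_pair_conj_gen_b[OF j False]] tree_pair_gen_b_inv] Gamma_id by auto
  qed
  ultimately show ?thesis using assms by auto
qed

lemma Gamma_lift: "h \<in> \<Gamma> \<Longrightarrow> \<exists>v\<in>\<Gamma>. tree_pair h v \<in> \<Gamma>"
proof (induction rule: generate.induct)
  case one
  have "tree_pair \<one>\<^bsub>W\<^esub> id \<in> \<Gamma>" using Gamma_id by simp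
  then show ?case using Gamma_id by blast
next
  case (incl h)
  then show ?case by (rule gen_lift)
next
  case (inv h)
  then obtain v where v: "v \<in> \<Gamma>" "tree_pair h v \<in> \<Gamma>" using gen_lift by blast
  have "h \<in> carrier W" using inv gens_in_W by blast
  then have "tree_pair (inv\<^bsub>W\<^esub> h) (inv\<^bsub>W\<^esub> v) \<in> \<Gamma>"
    using Gamma_inv[OF v(2)] by (simp add: inv_tree_pair Gamma_in_W[OF v(1)])
  then show ?case using Gamma_inv[OF v(1)] by blast
next
  case (eng h g)
  then obtain u v where "u \<in> \<Gamma>" "tree_pair h u \<in> \<Gamma>" "v \<in> \<Gamma>" "tree_pair g v \<in> \<Gamma>" by blast
  then have "u \<circ> v \<in> \<Gamma>" "tree_pair (h \<otimes>\<^bsub>W\<^esub> g) (u \<circ> v) \<in> \<Gamma>"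
    using Gamma_comp[of u v] Gamma_comp[of "tree_pair h u" "tree_pair g v"] by (simp_all add: tree_pair_comp)
  then show ?case by blast
qed

text \<open>Lift h to a pair (h, v) in \<open>\<Gamma>\<close> and conjugate (u, 1) by it: the
  second coordinate stays trivial.\<close>

lemma pair_kernel_conj:
  assumes u: "u \<in> pair_kernel" and h: "h \<in> \<Gamma>"
  shows "h \<circ> u \<circ> inv\<^bsub>W\<^esub> h \<in> pair_kernel"
proof -
  obtain v where v: "v \<in> \<Gamma>" "tree_pair h v \<in> \<Gamma>" using Gamma_lift[OF h] by blast
  have "tree_pair h v \<circ> tree_pair u id \<circ> inv\<^bsub>W\<^esub> (tree_pair h v) \<in> \<Gamma>"
    using Gamma_comp[OF Gamma_comp[OF v(2) pair_kernelD(2)[OF u]] Gamma_inv[OF v(2)]] .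
  moreover have "tree_pair h v \<circ> tree_pair u id \<circ> inv\<^bsub>W\<^esub> (tree_pair h v) =
      tree_pair (h \<circ> u \<circ> inv\<^bsub>W\<^esub> h) id"
    using W.r_inv[OF Gamma_in_W[OF v(1)]]
    by (simp add: inv_tree_pair[OF Gamma_in_W[OF h] Gamma_in_W[OF v(1)]] tree_pair_comp)
  ultimately show ?thesis
    using Gamma_comp[OF Gamma_comp[OF h pair_kernelD(1)[OF u]] Gamma_inv[OF h]] by (simp add: pair_kernel_def)
qed

abbreviation "\<alpha> \<equiv> gen_a r r"

lemma alpha_involution: "\<alpha> \<circ> \<alpha> = id" "\<alpha> \<circ> (\<alpha> \<circ> u) = u" "inv\<^bsub>W\<^esub> \<alpha> = \<alpha>"
proof -
  show 1: "\<alpha> \<circ> \<alpha> = id" using gen_a_involution[of r] r by simp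
  show "\<alpha> \<circ> (\<alpha> \<circ> u) = u" unfolding comp_assoc[symmetric] 1 by simp
  show "inv\<^bsub>W\<^esub> \<alpha> = \<alpha>" by (rule W.inv_equality) (use 1 gen_a_r in simp_all)
qed

lemma pair_kernel_conj_alpha: "u \<in> pair_kernel \<Longrightarrow> \<alpha> \<circ> (u \<circ> \<alpha>) \<in> pair_kernel"
  using pair_kernel_conj[OF _ gen_a_r(1), of u] by (simp add: alpha_involution comp_assoc)

text \<open>In the product of (b_r, b_r^-1) with a_(r+1) = (a_r, b_r) the second coordinates
  cancel.\<close>

lemma gen_b_alpha_in_pair_kernel: "gen_b r r \<circ> \<alpha> \<in> pair_kernel"
proof -
  have a: "tree_pair \<alpha> (gen_b r r) \<in> \<Gamma>"
    using gen(4) gen_a_in_Gamma[of "r + 1"] by simp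
  have "tree_pair (gen_b r r \<circ> \<alpha>) id \<in> \<Gamma>"
    using Gamma_comp[OF tree_pair_gen_b_inv a] W.l_inv[OF gen_b_r(2)] by (simp add: tree_pair_comp)
  then show ?thesis using Gamma_comp[OF gen_b_r(1) gen_a_r(1)] by (simp add: pair_kernel_def)
qed

text \<open>The pair kernel is normal and contains all generators except \<open>a\<^sub>r\<close> and \<open>b\<^sub>r\<close>, and also
  \<open>b\<^sub>r a\<^sub>r\<close>; as \<open>a\<^sub>r\<close> is an involution, its index is at most two.\<close>

definition adjust :: "(word \<Rightarrow> word) \<Rightarrow> word \<Rightarrow> word" where
  "adjust u = (if level_sign (r - 1) u [] = 1 then u else u \<circ> \<alpha>)"

text \<open>Among the generators exactly a_r and b_r have root sign -1 at level r - 1; adjusting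
  turns them into 1 and b_r a_r. The others are first coordinates of (a_i, 1) = a_(i+1), or of
  b_(j+1) after undoing a conjugation by normality.\<close>

lemma adjust_gen:
  assumes "s \<in> gens"
  shows "adjust s \<in> pair_kernel"
proof -
  have "adjust (gen_a r i) \<in> pair_kernel" if "i \<ge> 1" for i
  proof (cases "i = r")
    case True
    then show ?thesis using r Gamma_id level_sign_gen_a_root[of r "r - 1"]
      by (simp add: adjust_def alpha_involution pair_kernel_def)
  next
    case False
    then show ?thesis
      using that gen(5)[of "i + 1"] gen_a_in_Gamma[of i] gen_a_in_Gamma[of "i + 1"]
        level_sign_gen_a_root[of i "r - 1"] r
      by (auto simp: adjust_def pair_kernel_def)
  qed
  moreover have "adjust (gen_b r j) \<in> pair_kernel" if j: "j \<in> {1..r}" for j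
  proof (cases "j = r")
    case True
    then show ?thesis using r level_sign_gen_b_root[of r "r - 1"] gen_b_alpha_in_pair_kernel
      by (simp add: adjust_def)
  next
    case False
    have "gen_b r r \<circ> gen_b r j \<circ> inv\<^bsub>W\<^esub> (gen_b r r) \<in> pair_kernel"
      using Gamma_comp[OF Gamma_comp[OF gen_b_r(1) gen_b_in_Gamma[OF j]] Gamma_inv[OF gen_b_r(1)]]
        tree_pair_conj_gen_b[OF j False] by (simp add: pair_kernel_def)
    from pair_kernel_conj[OF this Gamma_inv[OF gen_b_r(1)]] have "gen_b r j \<in> pair_kernel"
      unfolding W.inv_inv[OF gen_b_r(2)] comp_assoc inv_comp_cancel[OF gen_b_r(2)] comp_id .
    then show ?thesis
      using level_sign_gen_b_root[OF j, of "r - 1"] False j by (auto simp: adjust_def)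
  qed
  ultimately show ?thesis using assms by auto
qed

lemma adjust_comp:
  assumes u: "u \<in> \<Gamma>" "adjust u \<in> pair_kernel" and v: "v \<in> \<Gamma>" "adjust v \<in> pair_kernel"
  shows "adjust (u \<circ> v) \<in> pair_kernel"
proof -
  note s = level_sign_comp_root[OF Gamma_in_W[OF u(1)] Gamma_in_W[OF v(1)], of "r - 1"]
  consider "level_sign (r - 1) u [] = 1" "level_sign (r - 1) v [] = 1"
    | "level_sign (r - 1) u [] = 1" "level_sign (r - 1) v [] = -1"
    | "level_sign (r - 1) u [] = -1" "level_sign (r - 1) v [] = 1"
    | "level_sign (r - 1) u [] = -1" "level_sign (r - 1) v [] = -1"
    using level_sign_pm[of "r - 1" u "[]"] level_sign_pm[of "r - 1" v "[]"] by blast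
  then show ?thesis
  proof cases
    case 1
    then show ?thesis using s pair_kernel_comp[OF u(2) v(2)] by (simp add: adjust_def)
  next
    case 2
    then show ?thesis using s pair_kernel_comp[OF u(2) v(2)] by (simp add: adjust_def comp_assoc)
  next
    \<comment> \<open>Here (u \<open>\<alpha>\<close>)(\<open>\<alpha>\<close> v
      \<open>\<alpha>\<close>) = u v \<open>\<alpha>\<close>, and the second factor is in the kernel
      by normality. The next case is the same with v \<open>\<alpha>\<close> in place of v.\<close>
    case 3
    then show ?thesis using s pair_kernel_comp[OF u(2) pair_kernel_conj_alpha[OF v(2)]]
      by (simp add: adjust_def comp_assoc alpha_involution)
  next
    case 4
    then show ?thesis using s pair_kernel_comp[OF u(2) pair_kernel_conj_alpha[OF v(2)]]
      by (simp add: adjust_def comp_assoc alpha_involution)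
  qed
qed

lemma adjust_inv:
  assumes u: "u \<in> \<Gamma>" "adjust u \<in> pair_kernel"
  shows "adjust (inv\<^bsub>W\<^esub> u) \<in> pair_kernel"
proof -
  note s = level_sign_inv_root[OF Gamma_in_W[OF u(1)], of "r - 1"]
  show ?thesis
  proof (cases "level_sign (r - 1) u [] = 1")
    case True
    then show ?thesis using s u(2) pair_kernel_inv by (simp add: adjust_def)
  next
    case False
    have "inv\<^bsub>W\<^esub> (u \<circ> \<alpha>) = \<alpha> \<circ> inv\<^bsub>W\<^esub> u"
      using W.inv_mult_group[OF Gamma_in_W[OF u(1)] gen_a_r(2)] by (simp add: alpha_involution)
    moreover have "inv\<^bsub>W\<^esub> (u \<circ> \<alpha>) \<in> pair_kernel"
      using False u(2) pair_kernel_inv by (simp add: adjust_def)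
    ultimately have "\<alpha> \<circ> ((\<alpha> \<circ> inv\<^bsub>W\<^esub> u) \<circ> \<alpha>) \<in> pair_kernel"
      using pair_kernel_conj_alpha by simp
    then show ?thesis using False s by (simp add: adjust_def comp_assoc alpha_involution)
  qed
qed

lemma adjust_in_pair_kernel: "u \<in> \<Gamma> \<Longrightarrow> adjust u \<in> pair_kernel"
proof (induction rule: generate.induct)
  case one
  show "adjust \<one>\<^bsub>W\<^esub> \<in> pair_kernel" using Gamma_id by (simp add: adjust_def pair_kernel_def)
next
  case (incl h)
  then show ?case by (rule adjust_gen)
next
  case (inv h)
  then show ?case by (intro adjust_inv adjust_gen generate.incl)
next
  case (eng h g)
  then show "adjust (h \<otimes>\<^bsub>W\<^esub> g) \<in> pair_kernel" using adjust_comp[of h g] by simp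
qed

lemma tree_pair_kernel:
  assumes "u \<in> pair_kernel" "v \<in> pair_kernel"
  shows "tree_pair u v \<in> \<Gamma>"
  using Gamma_comp[OF pair_kernelD(2)[OF assms(1)] tree_pair_flip[OF pair_kernelD(2)[OF assms(2)]]]
  by (simp add: tree_pair_comp)

text \<open>If both signs are 1, the two coordinates are in the kernel. If both are -1, split off
  (\<open>\<alpha>\<close>, \<open>\<alpha>\<close>), which is a_(r+1) = (\<open>\<alpha>\<close>,
  b_r) with its second coordinate corrected by the inverse of the kernel element b_r
  \<open>\<alpha>\<close>.\<close>

lemma tree_pair_in_Gamma:
  assumes u: "u \<in> \<Gamma>" and v: "v \<in> \<Gamma>"
    and eq: "level_sign (r - 1) u [] = level_sign (r - 1) v []"
  shows "tree_pair u v \<in> \<Gamma>"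
proof -
  have K: "tree_pair (adjust u) (adjust v) \<in> \<Gamma>"
    using tree_pair_kernel u v adjust_in_pair_kernel by blast
  show ?thesis
  proof (cases "level_sign (r - 1) u [] = 1")
    case True
    then show ?thesis using K eq by (simp add: adjust_def)
  next
    case False
    have "tree_pair \<alpha> (gen_b r r) \<in> \<Gamma>"
      using gen(4) gen_a_in_Gamma[of "r + 1"] by simp
    moreover have "inv\<^bsub>W\<^esub> (gen_b r r \<circ> \<alpha>) = \<alpha> \<circ> inv\<^bsub>W\<^esub> (gen_b r r)"
      using W.inv_mult_group[OF gen_b_r(2) gen_a_r(2)] by (simp add: alpha_involution)
    moreover have "tree_pair id (inv\<^bsub>W\<^esub> (gen_b r r \<circ> \<alpha>)) \<in> \<Gamma>"
      using gen_b_alpha_in_pair_kernel pair_kernel_inv pair_kernelD(2) tree_pair_flip by blast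
    ultimately have "tree_pair id (\<alpha> \<circ> inv\<^bsub>W\<^esub> (gen_b r r)) \<circ> tree_pair \<alpha> (gen_b r r) \<in> \<Gamma>"
      using Gamma_comp by simp
    moreover have "tree_pair id (\<alpha> \<circ> inv\<^bsub>W\<^esub> (gen_b r r)) \<circ> tree_pair \<alpha> (gen_b r r) =
        tree_pair \<alpha> \<alpha>"
      using W.l_inv[OF gen_b_r(2)] by (simp add: tree_pair_comp comp_assoc)
    ultimately have "tree_pair \<alpha> \<alpha> \<in> \<Gamma>" by simp
    from Gamma_comp[OF K this] show ?thesis
      using False eq by (simp add: adjust_def tree_pair_comp comp_assoc alpha_involution)
  qed
qed

section \<open>Density level by level, and membership in G(r) and G~(r)\<close>

lemma level_signs_in_Gamma:
  assumes g: "g \<in> carrier W"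
  shows "n \<le> r \<Longrightarrow> \<exists>h\<in>\<Gamma>. \<forall>m<n. level_sign m h [] = level_sign m g []"
proof (induction n)
  case 0
  then show ?case using Gamma_id by blast
next
  case (Suc n)
  then obtain h where h: "h \<in> \<Gamma>" "\<forall>m<n. level_sign m h [] = level_sign m g []" by auto
  show ?case
  proof (cases "level_sign n h [] = level_sign n g []")
    case True
    then show ?thesis using h less_Suc_eq by (intro bexI[of _ h]) auto
  next
    case False
    \<comment> \<open>Its root sign is -1 at level n only, so multiplying by it repairs level n
      without disturbing the levels already matched.\<close>
    have a: "gen_a r (Suc n) \<in> \<Gamma>" using gen_a_in_Gamma by simp
    have "level_sign m (h \<circ> gen_a r (Suc n)) [] = level_sign m g []" if "m < Suc n" for m
      using h that False Suc.prems level_sign_gen_a_root[of "Suc n" m]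
        level_sign_pm[of n h "[]"] level_sign_pm[of n g "[]"]
      by (auto simp: level_sign_comp_root Gamma_in_W[OF a] Gamma_in_W less_Suc_eq)
    then show ?thesis using Gamma_comp[OF h(1) a] by blast
  qed
qed

text \<open>Induction on the depth n through the sections. The root signs at levels below r are
  carried along because agreement to a small depth does not determine them, while combining two
  approximations into a pair in \<open>\<Gamma>\<close> needs equal signs at level r - 1.\<close>

lemma dense_Gamma:
  assumes "g \<in> carrier W" "\<And>t. level_sign r g t = 1"
  shows "\<exists>h\<in>\<Gamma>. (\<forall>t. length t \<le> n \<longrightarrow> h t = g t) \<and> (\<forall>m<r. level_sign m h [] = level_sign m g [])"
  using assms
proof (induction n arbitrary: g)
  case 0
  then show ?case using level_signs_in_Gamma[OF 0(1), of r] Gamma_in_W by auto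
next
  case (Suc n)
  have *: "\<exists>h\<in>\<Gamma>. (\<forall>t. length t \<le> Suc n \<longrightarrow> h t = tree_pair u v t) \<and>
      (\<forall>m<r. level_sign m h [] = level_sign m (tree_pair u v) [])"
    if u: "u \<in> carrier W" and v: "v \<in> carrier W"
      and s: "\<And>t. level_sign r (tree_pair u v) t = 1" for u v
  proof -
    have "level_sign r u t = 1" "level_sign r v t = 1" for t
      using s[of "False # t"] s[of "True # t"] u v by (simp_all add: level_sign_tree_pair)
    then obtain u' v' where u': "u' \<in> \<Gamma>" "\<And>t. length t \<le> n \<Longrightarrow> u' t = u t"
        "\<And>m. m < r \<Longrightarrow> level_sign m u' [] = level_sign m u []"
      and v': "v' \<in> \<Gamma>" "\<And>t. length t \<le> n \<Longrightarrow> v' t = v t"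
        "\<And>m. m < r \<Longrightarrow> level_sign m v' [] = level_sign m v []"
      using Suc.IH[OF u] Suc.IH[OF v] by metis
    \<comment> \<open>This is the hypothesis at the root: P_r of a pair there is the product of
      P_(r-1) of its coordinates.\<close>
    have "level_sign (r - 1) u [] * level_sign (r - 1) v [] = 1"
      using s[of "[]"] level_sign_tree_pair(4)[OF u v, of "r - 1"] r by simp
    then have "level_sign (r - 1) u' [] = level_sign (r - 1) v' []"
      using u'(3)[of "r - 1"] v'(3)[of "r - 1"] r
        level_sign_pm[of "r - 1" u "[]"] level_sign_pm[of "r - 1" v "[]"] by auto
    then have "tree_pair u' v' \<in> \<Gamma>" using tree_pair_in_Gamma u' v' by blast
    moreover have "tree_pair u' v' t = tree_pair u v t" if "length t \<le> Suc n" for t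
      using tree_pair_agree[of n u' u v' v t] u'(2) v'(2) that by blast
    moreover have "level_sign m (tree_pair u' v') [] = level_sign m (tree_pair u v) []"
      if "m < r" for m
      using u' v' u v that by (cases m) (simp_all add: level_sign_tree_pair Gamma_in_W)
    ultimately show ?thesis by blast
  qed
  show ?case using Suc.prems(1)
  proof (cases rule: W_cases)
    case (1 u v)
    then show ?thesis using *[of u v] Suc.prems(2) by simp
  next
    case (2 u v)
    have W: "tree_pair u v \<in> carrier W" using 2 tree_pair_in_W by blast
    \<comment> \<open>The swap acts at the root only, which is at distance less than r from it; so
      removing the swap preserves the sign hypothesis.\<close>
    have "level_sign r tree_swap t = 1" for t
      using r level_sign_tree_swap(3)[of "r - 1"] by (cases t) (simp_all add: level_sign_tree_swap)
    then have "level_sign r (tree_pair u v) (tree_swap t) = 1" for t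
      using Suc.prems(2)[of t] unfolding 2 level_sign_comp[OF W tree_swap_in_W] by simp
    moreover have "tree_swap (tree_swap t) = t" for t by (cases t) simp_all
    ultimately have "level_sign r (tree_pair u v) t = 1" for t by metis
    from *[OF 2(1,2) this] obtain h where h: "h \<in> \<Gamma>"
      "\<And>t. length t \<le> Suc n \<Longrightarrow> h t = tree_pair u v t"
      "\<And>m. m < r \<Longrightarrow> level_sign m h [] = level_sign m (tree_pair u v) []" by blast
    have "level_sign m (h \<circ> tree_swap) [] = level_sign m g []" if "m < r" for m
      unfolding 2 level_sign_comp_root[OF W tree_swap_in_W]
        level_sign_comp_root[OF Gamma_in_W[OF h(1)] tree_swap_in_W] h(3)[OF that] ..
    moreover have "(h \<circ> tree_swap) t = g t" if "length t \<le> Suc n" for t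
      using h(2)[of "tree_swap t"] that 2 by simp
    ultimately show ?thesis using Gamma_comp[OF h(1) swap_in_Gamma] by blast
  qed
qed

lemma in_G:
  assumes "g \<in> carrier W" "\<And>t. level_sign r g t = 1"
  shows "g \<in> G r"
  unfolding G_def using dense_Gamma[OF assms] Gamma_in_W by (intro W_closure_ofI[OF assms(1)]) blast

text \<open>The sections of w~ are w~ and b_r w~, so at the root the two signs of w~ cancel and the
  sign -1 of b_r at level r - 1 remains. Deeper down, b_r contributes nothing to P_r.\<close>

lemma level_sign_w_tilde: "level_sign r (w_tilde r) t = -1"
proof -
  note w = w_tilde_eq[OF r]
  have bw: "gen_b r r \<circ> w_tilde r \<in> carrier W" using gen_b_r w(1) comp_in_W by blast
  have wt: "w_tilde r = tree_pair (w_tilde r) (gen_b r r \<circ> w_tilde r)" using w(2) by simp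
  have S: "level_sign (Suc m) (w_tilde r) [] = level_sign m (gen_b r r) []" for m
    by (subst wt) (simp add: level_sign_tree_pair w(1) bw level_sign_comp_root gen_b_r)
  show ?thesis
  proof (induction t)
    case Nil
    then show ?case using S[of "r - 1"] r level_sign_gen_b_root[of r "r - 1"] by simp
  next
    case (Cons c t)
    have b: "level_sign r (gen_b r r) s = 1" for s using level_sign_gen_b[of r] r by simp
    show ?case
      by (subst wt, cases c) (simp_all add: level_sign_tree_pair w(1) bw level_sign_comp gen_b_r b Cons)
  qed
qed

lemma in_G_tilde:
  assumes g: "g \<in> carrier W" and s: "\<And>t. level_sign r g t = level_sign r g []"
  shows "g \<in> G_tilde r"
proof (cases "level_sign r g [] = 1")
  case True
  then show ?thesis
    unfolding G_tilde_def using in_G[OF g] s by (auto intro: generate.incl)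
next
  case False
  then have m: "level_sign r g t = -1" for t using s level_sign_pm[of r g "[]"] by metis
  note w = w_tilde_eq(1)[OF r]
  let ?h = "g \<circ> inv\<^bsub>W\<^esub> (w_tilde r)"
  have "?h \<in> G r"
    using g w by (intro in_G)
      (simp_all add: comp_in_W level_sign_comp level_sign_inv m level_sign_w_tilde)
  then have "?h \<otimes>\<^bsub>W\<^esub> w_tilde r \<in> G_tilde r"
    unfolding G_tilde_def by (intro generate.eng generate.incl) simp_all
  moreover have "?h \<otimes>\<^bsub>W\<^esub> w_tilde r = g"
    using W.l_inv[OF w] by (simp add: comp_assoc)
  ultimately show ?thesis by simp
qed

end

subsection \<open>Quadratic rational functions in homogeneous coordinates\<close>

text \<open>For nonzero z the linear form \<open>cross z\<close> vanishes exactly on the line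
  spanned by z, so quotients of such forms are functions with known zeros and poles.\<close>

definition cross :: "'a::field \<times> 'a \<Rightarrow> 'a \<times> 'a \<Rightarrow> 'a" where
  "cross v w = fst v * snd w - snd v * fst w"

fun homog :: "'a::field proj_line \<Rightarrow> 'a \<times> 'a" where
  "homog (Affine x) = (x, 1)"
| "homog Infty = (1, 0)"

definition proj :: "'a::field \<times> 'a \<Rightarrow> 'a proj_line" where
  "proj v = (if snd v = 0 then Infty else Affine (fst v / snd v))"

text \<open>The homogenization has degree two even if p has smaller degree; thus infinity needs no
  separate formula.\<close>

definition quad_form :: "'a::field poly \<Rightarrow> 'a \<times> 'a \<Rightarrow> 'a" where
  "quad_form p v = coeff p 0 * snd v * snd v + coeff p 1 * fst v * snd v + coeff p 2 * fst v * fst v"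

definition homog_map :: "'a::field ratfun \<Rightarrow> 'a \<times> 'a \<Rightarrow> 'a \<times> 'a" where
  "homog_map f v = (quad_form (fst f) v, quad_form (snd f) v)"

lemma homog_nonzero [simp]: "homog z \<noteq> 0"
  by (cases z) (simp_all add: zero_prod_def)

lemma cross_eq_0_iff_proj:
  assumes "v \<noteq> 0" "w \<noteq> 0"
  shows "cross v w = 0 \<longleftrightarrow> proj v = proj w"
  using assms by (cases v; cases w)
    (auto simp: cross_def proj_def zero_prod_def field_simps)

lemma proj_homog [simp]: "proj (homog z) = z"
  by (cases z) (simp_all add: proj_def)

lemma cross_homog_eq_0_iff [simp]: "cross (homog y) (homog z) = 0 \<longleftrightarrow> y = z"
  by (simp add: cross_eq_0_iff_proj)

lemma cross_eq_0D:
  assumes "cross v w = 0" "v \<noteq> 0" "w \<noteq> 0"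
  shows "\<exists>c. c \<noteq> 0 \<and> v = (c * fst w, c * snd w)"
proof (cases "snd w = 0")
  case True
  then have "fst w \<noteq> 0" using assms(3) by (simp add: prod_eq_iff zero_prod_def)
  moreover have "snd v = 0" using assms(1) True \<open>fst w \<noteq> 0\<close> by (simp add: cross_def)
  moreover have "fst v \<noteq> 0" using assms(2) \<open>snd v = 0\<close> by (simp add: prod_eq_iff zero_prod_def)
  ultimately show ?thesis using True by (intro exI[of _ "fst v / fst w"]) (simp add: prod_eq_iff)
next
  case False
  have e: "fst v * snd w = snd v * fst w" using assms(1) by (simp add: cross_def)
  have "snd v \<noteq> 0"
  proof
    assume "snd v = 0"
    then show False using e False assms(2) by (simp add: prod_eq_iff zero_prod_def)
  qed
  then show ?thesis using False e
    by (intro exI[of _ "snd v / snd w"]) (simp add: prod_eq_iff field_simps)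
qed

lemma cross_plucker: "cross u v * cross w z = cross u w * cross v z - cross u z * cross v w"
  by (simp add: cross_def algebra_simps)

lemma quad_form_scale: "quad_form p (c * X, c * Y) = c * c * quad_form p (X, Y)"
  by (simp add: quad_form_def algebra_simps)

lemma homog_map_scale:
  "homog_map f (c * X, c * Y) =
     (c * c * fst (homog_map f (X, Y)), c * c * snd (homog_map f (X, Y)))"
  by (simp add: homog_map_def quad_form_scale)

lemma poly_le_2:
  fixes p :: "'a::comm_ring_1 poly"
  assumes "degree p \<le> 2"
  shows "p = [:coeff p 0, coeff p 1, coeff p 2:]"
proof (rule poly_eqI)
  fix n :: nat
  consider "n = 0" | "n = 1" | "n = 2" | "n > 2" by linarith
  then show "coeff p n = coeff [:coeff p 0, coeff p 1, coeff p 2:] n"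
  proof cases
    case 4
    then show ?thesis using assms
      by (simp add: coeff_eq_0 coeff_pCons split: nat.split)
  qed (simp_all add: numeral_2_eq_2)
qed

lemma poly_le_2_eval:
  fixes p :: "'a::field poly"
  assumes "degree p \<le> 2"
  shows "poly p x = quad_form p (x, 1)" "poly (pderiv p) x = coeff p 1 + 2 * coeff p 2 * x"
proof -
  have e: "poly [:c0, c1, c2:] x = c0 + c1 * x + c2 * x * x"
    "poly (pderiv [:c0, c1, c2:]) x = c1 + 2 * c2 * x" for c0 c1 c2
    by (simp_all add: pderiv_pCons algebra_simps)
  show "poly p x = quad_form p (x, 1)" "poly (pderiv p) x = coeff p 1 + 2 * coeff p 2 * x"
    using e(1) e(2) poly_le_2[OF assms] by (metis quad_form_def fst_conv snd_conv mult.right_neutral)+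
qed

lemma reflect_le_2:
  fixes p :: "'a::field poly"
  assumes "degree p \<le> 2"
  shows "monom 1 (2 - degree p) * reflect_poly p = [:coeff p 2, coeff p 1, coeff p 0:]"
proof (rule poly_eqI)
  fix i :: nat
  have "coeff (monom 1 (2 - degree p) * reflect_poly p) i = (if i \<le> 2 then coeff p (2 - i) else 0)"
    using assms by (auto simp: coeff_monom_mult coeff_reflect_poly intro!: coeff_eq_0 arg_cong[of _ _ "coeff p"])
  also have "\<dots> = coeff [:coeff p 2, coeff p 1, coeff p 0:] i"
  proof -
    consider "i = 0" | "i = 1" | "i = 2" | "i > 2" by linarith
    then show ?thesis
      by cases (simp_all add: numeral_2_eq_2 coeff_pCons split: nat.split)
  qed
  finally show "coeff (monom 1 (2 - degree p) * reflect_poly p) i =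
    coeff [:coeff p 2, coeff p 1, coeff p 0:] i" .
qed

section \<open>A quadratic map: critical points and fibres\<close>

locale quadratic_ratfun =
  fixes f :: "'a::field ratfun" and p\<^sub>0 q\<^sub>0 :: "'a proj_line"
  assumes coprime: "coprime (fst f) (snd f)"
    and degree: "ratfun_degree f = 2"
    and critical: "{z. ratfun_critical f z} = {p\<^sub>0, q\<^sub>0}"
    and two: "(2::'a) \<noteq> 0"
begin

abbreviation "a0 \<equiv> coeff (fst f) 0"
abbreviation "a1 \<equiv> coeff (fst f) 1"
abbreviation "a2 \<equiv> coeff (fst f) 2"
abbreviation "b0 \<equiv> coeff (snd f) 0"
abbreviation "b1 \<equiv> coeff (snd f) 1"
abbreviation "b2 \<equiv> coeff (snd f) 2"

abbreviation "F \<equiv> homog_map f"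

lemma degree_le: "degree (fst f) \<le> 2" "degree (snd f) \<le> 2"
  using degree by (auto simp: ratfun_degree_def)

lemma at_infty: "ratfun_at_infty f = ([:a2, a1, a0:], [:b2, b1, b0:])"
  unfolding ratfun_at_infty_def degree by (simp add: reflect_le_2 degree_le)

lemmas poly_f = poly_le_2_eval[OF degree_le(1)] poly_le_2_eval[OF degree_le(2)]

lemma ratfun_eval_eq: "ratfun_eval f z = proj (F (homog z))"
  by (cases z) (simp_all add: ratfun_eval_affine_def poly_f at_infty proj_def homog_map_def
      quad_form_def)

text \<open>A common zero of the two forms would be an affine common root, against coprimality, or
  infinity, against degree two.\<close>

lemma F_nonzero:
  assumes "v \<noteq> 0"
  shows "F v \<noteq> 0"
proof
  assume F: "F v = 0"
  have "homog_map f (homog (proj v)) = 0"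
  proof -
    obtain c where c: "c \<noteq> 0" "v = (c * fst (homog (proj v)), c * snd (homog (proj v)))"
      using cross_eq_0D[of v "homog (proj v)"] cross_eq_0_iff_proj[of v "homog (proj v)"] assms
      by auto
    then have "F v = (c * c * fst (F (homog (proj v))), c * c * snd (F (homog (proj v))))"
      using homog_map_scale[of f c "fst (homog (proj v))" "snd (homog (proj v))"] by simp
    then show ?thesis using F c(1) by (simp add: zero_prod_def prod_eq_iff)
  qed
  then show False
  proof (cases "proj v")
    case (Affine x)
    with \<open>F (homog (proj v)) = 0\<close> have r: "poly (fst f) x = 0" "poly (snd f) x = 0"
      by (simp_all add: poly_f homog_map_def zero_prod_def)
    have "is_unit [:- x, 1:]"
      using coprime r coprime_common_divisor poly_eq_0_iff_dvd by blast
    then show False by (simp add: is_unit_pCons_iff)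
  next
    case Infty
    with \<open>F (homog (proj v)) = 0\<close> have r: "a2 = 0" "b2 = 0"
      by (simp_all add: homog_map_def quad_form_def zero_prod_def)
    have "degree (fst f) = 2 \<or> degree (snd f) = 2"
      using degree by (auto simp: ratfun_degree_def max_def split: if_splits)
    then show False using r by (metis degree_0 leading_coeff_0_iff zero_neq_numeral)
  qed
qed

abbreviation "w0 \<equiv> a1 * b0 - a0 * b1"
abbreviation "w1 \<equiv> a2 * b0 - a0 * b2"
abbreviation "w2 \<equiv> a2 * b1 - a1 * b2"

text \<open>This homogenizes p' q - p q' for f = p/q; up to sign its coefficients \<open>w0\<close>,
  \<open>w1\<close>, \<open>w2\<close> are the minors of the coefficient matrix of p and q.\<close>

definition wronskian :: "'a \<times> 'a \<Rightarrow> 'a" where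
  "wronskian v = w0 * snd v * snd v + 2 * w1 * fst v * snd v + w2 * fst v * fst v"

lemma critical_iff: "ratfun_critical f z \<longleftrightarrow> wronskian (homog z) = 0"
proof (cases z)
  case (Affine x)
  have "poly (pderiv (fst f) * snd f - fst f * pderiv (snd f)) x = wronskian (x, 1)"
    by (simp add: poly_f wronskian_def quad_form_def algebra_simps)
  then show ?thesis using Affine by (simp add: ratfun_critical_affine_def)
next
  case Infty
  then show ?thesis
    by (simp add: ratfun_critical_affine_def at_infty pderiv_pCons wronskian_def algebra_simps)
      (metis mult.commute)
qed

text \<open>Otherwise every point would be critical, among them three distinct ones.\<close>

lemma wronskian_nonzero: "\<not> (w0 = 0 \<and> w1 = 0 \<and> w2 = 0)"
proof
  assume "w0 = 0 \<and> w1 = 0 \<and> w2 = 0"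
  then have "{Infty, Affine 0, Affine 1} \<subseteq> {z. ratfun_critical f z}"
    by (auto simp: critical_iff wronskian_def)
  then have "card {Infty, Affine 0, Affine (1::'a)} \<le> card {p\<^sub>0, q\<^sub>0}"
    unfolding critical by (intro card_mono) auto
  moreover have "card {p\<^sub>0, q\<^sub>0} \<le> 2" by (cases "p\<^sub>0 = q\<^sub>0") auto
  ultimately show False by simp
qed

text \<open>Both expand a 3 by 3 determinant with a repeated row.\<close>

lemma syzygy: "a0 * w2 - a1 * w1 + a2 * w0 = 0" "b0 * w2 - b1 * w1 + b2 * w0 = 0"
  by (simp_all add: algebra_simps)

text \<open>With only one critical point the Wronskian has a double zero there. Its coefficients are
  then proportional to (x^2, -x, 1), or to (1, 0, 0) at infinity, and the syzygies say that both
  forms of f vanish at this point.\<close>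

lemma critical_distinct: "p\<^sub>0 \<noteq> q\<^sub>0"
proof
  assume eq: "p\<^sub>0 = q\<^sub>0"
  have u: "z = p\<^sub>0" if "wronskian (homog z) = 0" for z
    using that critical eq by (auto simp: critical_iff)
  have p: "wronskian (homog p\<^sub>0) = 0" using critical by (auto simp: critical_iff[symmetric])
  show False
  proof (cases p\<^sub>0)
    case Infty
    then have w2: "w2 = 0" using p by (simp add: wronskian_def)
    have w1: "w1 = 0"
    proof (rule ccontr)
      assume "w1 \<noteq> 0"
      then have "wronskian (homog (Affine (- w0 / (2 * w1)))) = 0"
        using w2 two by (simp add: wronskian_def)
      from u[OF this] Infty show False by simp
    qed
    have "w0 \<noteq> 0" using wronskian_nonzero w1 w2 by blast
    moreover have "a2 * w0 = 0" using syzygy(1) unfolding w1 w2 by simp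
    moreover have "b2 * w0 = 0" using syzygy(2) unfolding w1 w2 by simp
    ultimately have "a2 = 0" "b2 = 0" by (metis mult_eq_0_iff)+
    then have "F (1, 0) = 0" by (simp add: homog_map_def quad_form_def zero_prod_def)
    then show False using F_nonzero[of "(1, 0)"] by (simp add: zero_prod_def)
  next
    case (Affine x)
    have w2: "w2 \<noteq> 0"
    proof
      assume "w2 = 0"
      then have "wronskian (homog Infty) = 0" by (simp add: wronskian_def)
      from u[OF this] Affine show False by simp
    qed
    have px: "w0 + 2 * w1 * x + w2 * x * x = 0" using p Affine by (simp add: wronskian_def)
    \<comment> \<open>The second root of the Wronskian by Vieta; it must equal x, which determines
      \<open>w1\<close> since 2 is invertible.\<close>
    define y where "y = - 2 * w1 / w2 - x"
    have wy: "w2 * y = - 2 * w1 - w2 * x" using w2 by (simp add: y_def field_simps)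
    have "c0 + 2 * c1 * y + c2 * y * y = 0"
      if "c2 * y = - 2 * c1 - c2 * x" "c0 + 2 * c1 * x + c2 * x * x = 0" for c0 c1 c2
      using that by algebra
    from this[OF wy px] have "wronskian (homog (Affine y)) = 0"
      by (simp only: wronskian_def homog.simps fst_conv snd_conv mult_1_right)
    from u[OF this] Affine have "y = x" by simp
    have 1: "c1 = - c2 * x" if "c2 * x = - 2 * c1 - c2 * x" for c1 c2
    proof -
      have "2 * (c1 + c2 * x) = 0" using that by algebra
      then have "c1 + c2 * x = 0" using two by (metis mult_eq_0_iff)
      then show ?thesis by (simp add: eq_neg_iff_add_eq_0)
    qed
    have w1: "w1 = - w2 * x" using 1[of w2 w1] wy unfolding \<open>y = x\<close> .
    have "c0 = c2 * x * x" if "c0 + 2 * c1 * x + c2 * x * x = 0" "c1 = - c2 * x" for c0 c1 c2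
      using that by algebra
    from this[OF px w1] have w0: "w0 = w2 * x * x" .
    have "w2 * quad_form (fst f) (x, 1) = a0 * w2 - a1 * (- w2 * x) + a2 * (w2 * x * x)"
      by (simp add: quad_form_def algebra_simps)
    also have "\<dots> = 0" using syzygy(1) unfolding w0 w1 .
    finally have 1: "quad_form (fst f) (x, 1) = 0" using w2 by simp
    have "w2 * quad_form (snd f) (x, 1) = b0 * w2 - b1 * (- w2 * x) + b2 * (w2 * x * x)"
      by (simp add: quad_form_def algebra_simps)
    also have "\<dots> = 0" using syzygy(2) unfolding w0 w1 .
    finally have "F (x, 1) = 0" using w2 1 by (simp add: homog_map_def zero_prod_def)
    then show False using F_nonzero[of "(x, 1)"] by (simp add: zero_prod_def)
  qed
qed

text \<open>A linear relation between the two forms would make all minors vanish.\<close>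

lemma pencil_nonzero:
  assumes "x \<noteq> 0"
  shows "\<exists>v. cross x (F v) \<noteq> 0"
proof (rule ccontr)
  assume "\<nexists>v. cross x (F v) \<noteq> 0"
  then have "cross x (F v) = 0" for v by blast
  then have z: "fst x * quad_form (snd f) v = snd x * quad_form (fst f) v" for v
    by (simp add: cross_def homog_map_def)
  have 2: "fst x * b2 = snd x * a2" using z[of "(1, 0)"] by (simp add: quad_form_def)
  have 0: "fst x * b0 = snd x * a0" using z[of "(0, 1)"] by (simp add: quad_form_def)
  have 1: "fst x * b1 = snd x * a1"
    using z[of "(1, 1)"] 0 2 by (simp add: quad_form_def algebra_simps)
  have "fst x * w0 = 0" "fst x * w1 = 0" "fst x * w2 = 0" "snd x * w0 = 0" "snd x * w1 = 0"
    "snd x * w2 = 0"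
    using 0 1 2 by algebra+
  then show False using assms wronskian_nonzero by (auto simp: zero_prod_def prod_eq_iff)
qed

text \<open>The left side is a quadratic form in v vanishing at the two distinct points z and z',
  hence a multiple of the product of their linear forms.\<close>

lemma pullback_factor:
  assumes x: "x \<noteq> 0" and z: "cross x (F z) = 0" and z': "cross x (F z') = 0"
    and n: "cross z z' \<noteq> 0"
  shows "\<exists>c. c \<noteq> 0 \<and> (\<forall>v. cross x (F v) = c * (cross z v * cross z' v))"
proof -
  obtain x1 x2 where xx: "x = (x1, x2)" by (cases x)
  obtain z1 z2 where zz: "z = (z1, z2)" by (cases z)
  obtain y1 y2 where yy: "z' = (y1, y2)" by (cases z')
  define c0 where "c0 = x1 * b0 - x2 * a0"
  define c1 where "c1 = x1 * b1 - x2 * a1"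
  define c2 where "c2 = x1 * b2 - x2 * a2"
  have q: "cross x (F (s, t)) = c0 * t * t + c1 * s * t + c2 * s * s" for s t
    by (simp add: xx cross_def homog_map_def quad_form_def c0_def c1_def c2_def algebra_simps)
  \<comment> \<open>This is the polar form of the quadratic form at z and z'. Expanding the form at
    e v, a combination of z and z', gives the identity below.\<close>
  define d where "d = 2 * c0 * z2 * y2 + c1 * (z1 * y2 + z2 * y1) + 2 * c2 * z1 * y1"
  define e where "e = cross z z'"
  have id: "e * e * cross x (F v) = - d * (cross z v * cross z' v)" for v
  proof -
    obtain s t where v: "v = (s, t)" by (cases v)
    have 1: "c0 * z2 * z2 + c1 * z1 * z2 + c2 * z1 * z1 = 0" using z q[of z1 z2] zz by simp
    have 2: "c0 * y2 * y2 + c1 * y1 * y2 + c2 * y1 * y1 = 0" using z' q[of y1 y2] yy by simp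
    have "e * e * (c0 * t * t + c1 * s * t + c2 * s * s) + d * (cross z v * cross z' v)
       = (cross z' v)^2 * (c0 * z2 * z2 + c1 * z1 * z2 + c2 * z1 * z1)
         + (cross z v)^2 * (c0 * y2 * y2 + c1 * y1 * y2 + c2 * y1 * y1)"
      unfolding e_def d_def cross_def v zz yy fst_conv snd_conv by algebra
    then show ?thesis using 1 2 q[of s t] v by (simp add: eq_neg_iff_add_eq_0)
  qed
  have e: "e \<noteq> 0" using n by (simp add: e_def)
  define c where "c = - d / (e * e)"
  have c: "cross x (F v) = c * (cross z v * cross z' v)" for v
    using id[of v] e by (simp add: c_def field_simps)
  moreover have "c \<noteq> 0" using pencil_nonzero[OF x] c by auto
  ultimately show ?thesis by blast
qed

text \<open>The form always has the factor \<open>cross p v\<close>; the cofactor is the polar form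
  of the Wronskian at p, which vanishes at p when p is critical and so supplies the same factor
  again.\<close>

lemma critical_factor:
  assumes "wronskian p = 0" and p: "p \<noteq> 0"
  shows "\<exists>c. c \<noteq> 0 \<and> (\<forall>v. cross (F p) (F v) = c * (cross p v * cross p v))"
proof -
  obtain X Y where pp: "p = (X, Y)" by (cases p)
  have w: "(w0 * Y + w1 * X) * Y + (w1 * Y + w2 * X) * X = 0"
    using assms(1) by (simp add: wronskian_def pp algebra_simps)
  have id: "cross (F p) (F v) = cross p v *
      ((w0 * Y + w1 * X) * snd v + (w1 * Y + w2 * X) * fst v)" for v
    unfolding cross_def homog_map_def quad_form_def pp fst_conv snd_conv by algebra
  have "cross p (- (w0 * Y + w1 * X), w1 * Y + w2 * X) = 0"
    using w by (simp add: cross_def pp algebra_simps)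
  have "\<exists>c. w0 * Y + w1 * X = c * X \<and> w1 * Y + w2 * X = - c * Y"
  proof (cases "X = 0")
    case True
    then have "Y \<noteq> 0" using p pp by (simp add: zero_prod_def)
    then show ?thesis using True w by (intro exI[of _ "- w1"]) simp
  next
    case False
    then show ?thesis using w
      by (intro exI[of _ "(w0 * Y + w1 * X) / X"]) (simp add: field_simps eq_neg_iff_add_eq_0)
  qed
  then obtain c where c: "w0 * Y + w1 * X = c * X" "w1 * Y + w2 * X = - c * Y" by blast
  have "cross (F p) (F v) = c * (cross p v * cross p v)" for v
    unfolding id c by (simp add: cross_def pp algebra_simps)
  moreover from this have "c \<noteq> 0" using pencil_nonzero[OF F_nonzero[OF p]] by auto
  ultimately show ?thesis by blast
qed

end

subsection \<open>The preimage tree and the Galois action\<close>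

text \<open>Every t gets a private vertex at distance r below it, at which its sign can be set
  without affecting P_r anywhere else.\<close>

lemma level_sign_prescribed:
  assumes \<chi>: "\<And>t. \<chi> t = 1 \<or> \<chi> t = (-1::int)"
  shows "\<exists>g\<in>carrier W. \<forall>t. level_sign r g t = \<chi> t"
proof -
  \<comment> \<open>Marks t followed by r letters False whenever \<open>\<chi> t\<close> is -1; g
    will exchange the children of exactly the marked vertices.\<close>
  define \<pi> where "\<pi> y \<longleftrightarrow> (\<exists>t. y = t @ replicate r False \<and> \<chi> t = -1)" for y
  define g where "g t = map (\<lambda>i. t ! i \<noteq> \<pi> (take i t)) [0..<length t]" for t
  have g_snoc: "g (t @ [c]) = g t @ [c \<noteq> \<pi> t]" for t c
    by (simp add: g_def nth_append)
  have len: "length (g t) = length t" for t by (simp add: g_def)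
  have "s = t" if "g s = g t" for s t
    using that
  proof (induction t arbitrary: s rule: rev_induct)
    case Nil
    then show ?case using len[of s] by (simp add: g_def)
  next
    case (snoc c t)
    from snoc.prems len obtain s' d where s: "s = s' @ [d]"
      by (metis length_0_conv list.size(3) rev_exhaust snoc_eq_iff_butlast)
    then show ?case using snoc.prems snoc.IH[of s'] by (auto simp: g_snoc)
  qed
  then have W: "g \<in> carrier W"
    using g_snoc len by (intro carrier_W_I injI) auto
  have sign: "node_sign g y = (if \<pi> y then -1 else 1)" for y
    by (simp add: node_sign_def g_snoc)
  have "level_sign m g (t @ s) = (if s = replicate (r - m) False then \<chi> t else 1)"
    if "length s + m = r" for m s t
    using that
  proof (induction m arbitrary: s)
    case 0
    then have "\<pi> (t @ s) \<longleftrightarrow> s = replicate r False \<and> \<chi> t = -1" by (auto simp: \<pi>_def)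
    then show ?case using \<chi>[of t] by (auto simp: level_sign_def sign)
  next
    case (Suc m)
    have "r - m = Suc (r - Suc m)" using Suc.prems by simp
    then have "replicate (r - m) False = replicate (r - Suc m) False @ [False]"
      by (simp add: replicate_append_same)
    then show ?case
      using Suc.IH[of "s @ [False]"] Suc.IH[of "s @ [True]"] Suc.prems
      by (simp add: level_sign_def)
  qed
  from this[of "[]" r] have "level_sign r g t = \<chi> t" for t by simp
  with W show ?thesis by blast
qed

lemma descendant_prod_const: "descendant_prod m (\<lambda>_. c) t = c ^ 2 ^ m"
  by (induction m arbitrary: t) (simp_all add: mult_2 power_add)

section \<open>Functions with divisor p - q and their norms\<close>

context quadratic_ratfun
begin

text \<open>A function with divisor v - w. Vectors are kept instead of points because their scaling
  fixes the constant factor.\<close>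

definition ratio :: "'a \<times> 'a \<Rightarrow> 'a \<times> 'a \<Rightarrow> 'a proj_line \<Rightarrow> 'a" where
  "ratio v w z = cross (homog z) v / cross (homog z) w"

definition coord :: "'a proj_line \<Rightarrow> 'a" where
  "coord = ratio (homog p\<^sub>0) (homog q\<^sub>0)"

lemma cross_F_eq_0:
  assumes "ratfun_eval f z = y"
  shows "cross (homog y) (F (homog z)) = 0"
  using assms by (simp add: cross_eq_0_iff_proj F_nonzero ratfun_eval_eq)

text \<open>The constant in \<open>pullback_factor\<close> does not depend on v, so it cancels in
  the quotient.\<close>

lemma ratio_norm:
  assumes "ratfun_eval f z = y" "ratfun_eval f z' = y" "z \<noteq> z'"
  shows "ratio v w z * ratio v w z' = ratio (F v) (F w) y"
proof -
  obtain c where "c \<noteq> 0"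
    "\<And>v. cross (homog y) (F v) = c * (cross (homog z) v * cross (homog z') v)"
    using pullback_factor[of "homog y" "homog z" "homog z'"] assms cross_F_eq_0 by auto
  then show ?thesis by (simp add: ratio_def)
qed

lemma critical_points: "wronskian (homog p\<^sub>0) = 0" "wronskian (homog q\<^sub>0) = 0"
  using critical by (auto simp: critical_iff[symmetric])

text \<open>By \<open>critical_factor\<close> the squares of \<open>cross v\<close> at z and z'
  differ by the same scalar for both critical points v, so the coordinates have equal
  squares.\<close>

lemma coord_conjugate:
  assumes f: "ratfun_eval f z = ratfun_eval f z'" and n: "z \<noteq> z'"
    and q: "z \<noteq> q\<^sub>0" "z' \<noteq> q\<^sub>0"
  shows "coord z' = - coord z"
proof -
  let ?p = "homog p\<^sub>0" and ?q = "homog q\<^sub>0" and ?z = "homog z" and ?z' = "homog z'"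
  obtain c where c: "c \<noteq> 0" "F ?z' = (c * fst (F ?z), c * snd (F ?z))"
    using cross_eq_0D[of "F ?z'" "F ?z"] f
    by (auto simp: cross_eq_0_iff_proj F_nonzero ratfun_eval_eq)
  have sq: "cross v ?z' * cross v ?z' = c * (cross v ?z * cross v ?z)"
    if v: "wronskian v = 0" "v \<noteq> 0" for v
  proof -
    obtain e where e: "e \<noteq> 0" "\<And>w. cross (F v) (F w) = e * (cross v w * cross v w)"
      using critical_factor[OF v] by blast
    have "cross (F v) (F ?z') = c * cross (F v) (F ?z)"
      unfolding c(2) by (simp add: cross_def algebra_simps)
    then have "e * (cross v ?z' * cross v ?z') = e * (c * (cross v ?z * cross v ?z))"
      unfolding e(2) by (simp only: mult.left_commute)
    then show ?thesis using e(1) by simp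
  qed
  define x where "x = cross ?p ?z' * cross ?q ?z"
  define y where "y = cross ?p ?z * cross ?q ?z'"
  have "x * x = y * y"
    using sq[of ?p] sq[of ?q] critical_points by (simp add: x_def y_def mult_ac)
  \<comment> \<open>This excludes equal coordinates: by the Pluecker relation they would force p_0 =
    q_0 or z = z'.\<close>
  moreover have "x \<noteq> y"
  proof
    assume "x = y"
    then have "cross ?p ?q * cross ?z ?z' = 0"
      using cross_plucker[of ?p ?q ?z ?z'] by (simp add: x_def y_def mult.commute)
    then show False using n critical_distinct by simp
  qed
  ultimately have "x = - y" by (simp add: square_eq_iff)
  then have "cross ?z' ?p * cross ?z ?q = - (cross ?z ?p * cross ?z' ?q)"
    unfolding x_def y_def by (simp add: cross_def algebra_simps)
  moreover have "cross ?z ?q \<noteq> 0" "cross ?z' ?q \<noteq> 0" using q by simp_all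
  ultimately show ?thesis by (simp add: coord_def ratio_def field_simps)
qed

lemma proj_F:
  assumes "v \<noteq> 0"
  shows "proj (F v) = ratfun_eval f (proj v)"
proof -
  let ?w = "homog (proj v)"
  obtain c where c: "c \<noteq> 0" "v = (c * fst ?w, c * snd ?w)"
    using cross_eq_0D[of v ?w] cross_eq_0_iff_proj[of v ?w] assms by auto
  then have "F v = (c * c * fst (F ?w), c * c * snd (F ?w))"
    using homog_map_scale[of f c "fst ?w" "snd ?w"] by simp
  then have "cross (F v) (F ?w) = 0" by (simp add: cross_def)
  then show ?thesis using assms by (simp add: cross_eq_0_iff_proj F_nonzero ratfun_eval_eq)
qed

lemma F_iterate: "(F ^^ n) (homog z) \<noteq> 0 \<and> proj ((F ^^ n) (homog z)) = (ratfun_eval f ^^ n) z"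
  by (induction n) (simp_all add: F_nonzero proj_F)

end

section \<open>Products of coordinates over the preimage tree\<close>

locale preimage_tree = quadratic_ratfun f p\<^sub>0 q\<^sub>0
  for f :: "'a::field ratfun" and p\<^sub>0 q\<^sub>0 +
  fixes x' :: "'a proj_line" and \<phi> :: "word \<Rightarrow> nat \<times> 'a proj_line" and r :: nat
  assumes not_postcritical: "x' \<notin> postcritical_orbit f"
    and identification: "tree_identification f x' \<phi>"
    and r: "r \<ge> 1"
    and collision: "(ratfun_eval f ^^ (r + 1)) p\<^sub>0 = (ratfun_eval f ^^ (r + 1)) q\<^sub>0"
begin

definition pt :: "word \<Rightarrow> 'a proj_line" where
  "pt t = snd (\<phi> t)"

lemma bij_\<phi>: "bij_betw \<phi> UNIV (preimage_tree_vertices f x')"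
  and \<phi>_Nil: "\<phi> [] = (0, x')"
  and adj_\<phi>: "preimage_tree_adj f (\<phi> s) (\<phi> t) \<longleftrightarrow> word_adj s t"
  using identification unfolding tree_identification_def rooted_tree_iso_def by auto

lemma inj_\<phi>: "\<phi> s = \<phi> t \<Longrightarrow> s = t"
  using bij_\<phi> by (auto simp: bij_betw_def inj_on_def)

text \<open>A neighbour of a vertex in the preimage tree is a child or the parent, and the parent is
  already the image of the shorter word.\<close>

lemma \<phi>_step: "fst (\<phi> t) = length t \<and>
    (\<forall>c. fst (\<phi> (t @ [c])) = Suc (length t) \<and> ratfun_eval f (pt (t @ [c])) = pt t)"
proof (induction t rule: rev_induct)
  case Nil
  have "fst (\<phi> ([] @ [c])) = 1 \<and> ratfun_eval f (pt [c]) = pt []" for c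
    using adj_\<phi>[of "[]" "[c]"] \<phi>_Nil by (auto simp: word_adj_def preimage_tree_adj_def pt_def)
  then show ?case using \<phi>_Nil by simp
next
  case (snoc d t)
  have "fst (\<phi> (t @ [d, c])) = Suc (Suc (length t)) \<and> ratfun_eval f (pt (t @ [d, c])) = pt (t @ [d])"
    for c
  proof (rule ccontr)
    assume "\<not> ?thesis"
    moreover have "preimage_tree_adj f (\<phi> (t @ [d])) (\<phi> (t @ [d, c]))"
      unfolding adj_\<phi> by (simp add: word_adj_def)
    ultimately have "fst (\<phi> (t @ [d, c])) = length t" "pt (t @ [d, c]) = pt t"
      using snoc[THEN conjunct2, rule_format, of d] by (auto simp: preimage_tree_adj_def pt_def)
    then have "\<phi> (t @ [d, c]) = \<phi> t" using snoc by (simp add: prod_eq_iff pt_def)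
    from inj_\<phi>[OF this] show False by simp
  qed
  then show ?case using snoc by simp
qed

lemma \<phi>_eq: "\<phi> t = (length t, pt t)"
  using \<phi>_step[of t] by (simp add: prod_eq_iff pt_def)

lemma eval_pt_snoc: "ratfun_eval f (pt (t @ [c])) = pt t"
  using \<phi>_step[of t] by blast

lemma pt_inj: "length s = length t \<Longrightarrow> pt s = pt t \<Longrightarrow> s = t"
  using inj_\<phi>[of s t] by (simp add: \<phi>_eq)

lemma iterate_pt: "(ratfun_eval f ^^ length t) (pt t) = x'"
proof -
  have "\<phi> t \<in> preimage_tree_vertices f x'" using bij_\<phi> by (auto simp: bij_betw_def)
  then show ?thesis by (simp add: \<phi>_eq preimage_tree_vertices_def)
qed

text \<open>Otherwise \<open>length t\<close> further steps would put x' into the postcritical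
  orbit; the bound on n is there because that orbit starts with the first iterate.\<close>

lemma iterate_critical_neq:
  assumes z: "z = p\<^sub>0 \<or> z = q\<^sub>0" and n: "n + length t \<ge> 1"
  shows "(ratfun_eval f ^^ n) z \<noteq> pt t"
proof
  assume "(ratfun_eval f ^^ n) z = pt t"
  then have "(ratfun_eval f ^^ (length t + n)) z = x'"
    using iterate_pt[of t] by (simp add: funpow_add)
  moreover have "ratfun_critical f z" using critical z by blast
  ultimately have "x' \<in> postcritical_orbit f"
    unfolding postcritical_orbit_def using n by (intro UN_I[of "length t + n"]) auto
  then show False using not_postcritical by blast
qed

lemma pt_snoc_neq: "pt (t @ [c]) \<noteq> p\<^sub>0" "pt (t @ [c]) \<noteq> q\<^sub>0"
  using iterate_critical_neq[of p\<^sub>0 0 "t @ [c]"] iterate_critical_neq[of q\<^sub>0 0 "t @ [c]"] by auto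

lemma pt_sibling: "pt (t @ [c]) \<noteq> pt (t @ [\<not> c])"
  using pt_inj[of "t @ [c]" "t @ [\<not> c]"] by auto

lemma coord_sibling: "coord (pt (t @ [True])) = - coord (pt (t @ [False]))"
  by (rule coord_conjugate)
    (use pt_sibling[of t False] pt_snoc_neq in \<open>simp_all add: eval_pt_snoc\<close>)

text \<open>Here \<open>w\<close> is a relabelling of the tree: it decides which child of
  \<open>w t\<close> counts as the first.\<close>

definition child_coord :: "(word \<Rightarrow> word) \<Rightarrow> word \<Rightarrow> 'a" where
  "child_coord w t = coord (pt (w (t @ [False])))"

abbreviation "child_prod w \<equiv> descendant_prod r (child_coord w)"

text \<open>Relabelling by d selects the sibling exactly where d exchanges children, and siblings
  have opposite coordinates.\<close>

lemma child_coord_comp: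
  assumes "d \<in> carrier W" "w \<in> carrier W"
  shows "child_coord (w \<circ> d) t = of_int (node_sign d t) * child_coord w (d t)"
  using children_W[OF assms(1), of t] children_W[OF assms(2), of "d t"]
    coord_sibling[of "w (d t)"]
  by (auto simp: child_coord_def node_sign_def)

lemma child_prod_comp:
  assumes "d \<in> carrier W" "w \<in> carrier W"
  shows "child_prod (w \<circ> d) t = of_int (level_sign r d t) * child_prod w (d t)"
  unfolding child_coord_comp[OF assms, abs_def] descendant_prod_mult
    descendant_prod_comp[OF assms(1)] level_sign_def
  by (simp add: descendant_prod_hom[of of_int])

lemma ratio_descendants:
  "descendant_prod m (\<lambda>t. ratio v w (pt t)) t = ratio ((F ^^ m) v) ((F ^^ m) w) (pt t)"
proof (induction m arbitrary: t)
  case (Suc m)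
  then show ?case
    using ratio_norm[OF eval_pt_snoc eval_pt_snoc] pt_sibling[of t False] by simp
qed simp

text \<open>Since siblings have opposite coordinates, the square is minus the norm of the
  coordinate.\<close>

lemma child_coord_square:
  "child_coord id t * child_coord id t = - 1 * ratio (F (homog p\<^sub>0)) (F (homog q\<^sub>0)) (pt t)"
proof -
  have "coord (pt (t @ [False])) * coord (pt (t @ [True])) =
      ratio (F (homog p\<^sub>0)) (F (homog q\<^sub>0)) (pt t)"
    unfolding coord_def
    using ratio_norm[OF eval_pt_snoc eval_pt_snoc] pt_sibling[of t False] by simp
  then have "- (child_coord id t * child_coord id t) =
      ratio (F (homog p\<^sub>0)) (F (homog q\<^sub>0)) (pt t)"
    unfolding coord_sibling child_coord_def id_apply mult_minus_right .
  then show ?thesis by (metis add.inverse_inverse mult_minus1)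
qed

lemma child_prod_square:
  "\<exists>\<mu>. \<mu> \<noteq> 0 \<and> (\<forall>t. child_prod id t * child_prod id t = \<mu>)"
proof -
  define P where "P = (F ^^ (r + 1)) (homog p\<^sub>0)"
  define Q where "Q = (F ^^ (r + 1)) (homog q\<^sub>0)"
  have PQ: "P = (F ^^ r) (F (homog p\<^sub>0))" "Q = (F ^^ r) (F (homog q\<^sub>0))"
    by (simp_all add: P_def Q_def funpow_Suc_right del: funpow.simps)
  have nz: "P \<noteq> 0" "Q \<noteq> 0" and e: "proj P = proj Q" "proj Q = (ratfun_eval f ^^ (r + 1)) q\<^sub>0"
    using F_iterate[of "r + 1" p\<^sub>0] F_iterate[of "r + 1" q\<^sub>0] collision
    unfolding P_def Q_def by simp_all
  \<comment> \<open>By the collision P and Q represent the same point, so \<open>ratio P Q\<close>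
    is the constant \<open>\<mu>\<close>.\<close>
  then obtain \<mu> where \<mu>: "\<mu> \<noteq> 0" "P = (\<mu> * fst Q, \<mu> * snd Q)"
    using cross_eq_0D[of P Q] cross_eq_0_iff_proj[of P Q] by blast
  have "child_prod id t * child_prod id t = \<mu>" for t
  proof -
    have "child_prod id t * child_prod id t =
        descendant_prod r (\<lambda>t. - 1 * ratio (F (homog p\<^sub>0)) (F (homog q\<^sub>0)) (pt t)) t"
      unfolding descendant_prod_mult[symmetric] child_coord_square ..
    also have "\<dots> = (- 1) ^ 2 ^ r * ratio P Q (pt t)"
      unfolding descendant_prod_mult descendant_prod_const ratio_descendants PQ ..
    \<comment> \<open>The number 2^r of signs is even because r is at least 1.\<close>
    also have "\<dots> = ratio P Q (pt t)" using r by simp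
    also have "\<dots> = \<mu>"
    proof -
      have "cross (homog (pt t)) Q \<noteq> 0"
        using cross_eq_0_iff_proj[OF homog_nonzero nz(2), of "pt t"]
          iterate_critical_neq[of q\<^sub>0 "r + 1" t] e(2) by auto
      moreover have "cross (homog (pt t)) P = \<mu> * cross (homog (pt t)) Q"
        unfolding \<mu>(2) by (simp add: cross_def algebra_simps)
      ultimately show ?thesis by (simp add: ratio_def)
    qed
    finally show ?thesis .
  qed
  with \<mu> show ?thesis by blast
qed

lemma balanced_labelling:
  "\<exists>w\<in>carrier W. \<exists>\<nu>. \<nu> \<noteq> 0 \<and> (\<forall>t. child_prod w t = \<nu>)"
proof -
  obtain \<mu> where \<mu>: "\<mu> \<noteq> 0" "\<And>t. child_prod id t * child_prod id t = \<mu>"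
    using child_prod_square by blast
  define \<nu> where "\<nu> = child_prod id []"
  have pm: "child_prod id t = \<nu> \<or> child_prod id t = - \<nu>" for t
    unfolding \<nu>_def using \<mu>(2)[of t] \<mu>(2)[of "[]"] by (metis square_eq_iff)
  have \<nu>: "\<nu> \<noteq> 0" using \<mu>(1) \<mu>(2)[of "[]"] by (auto simp: \<nu>_def)
  define \<chi> where "\<chi> t = (if child_prod id t = \<nu> then 1 else (-1::int))" for t
  have "\<chi> t = 1 \<or> \<chi> t = -1" for t by (simp add: \<chi>_def)
  from level_sign_prescribed[of \<chi> r, OF this]
  obtain e where e: "e \<in> carrier W" "\<And>t. level_sign r e t = \<chi> t" by blast
  \<comment> \<open>With the inverse, the correcting sign is \<open>\<chi>\<close> at
    \<open>?w t\<close>, the very vertex at which the product for the old labelling is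
    evaluated.\<close>
  let ?w = "inv\<^bsub>W\<^esub> e"
  have w: "?w \<in> carrier W" using e(1) by simp
  have "child_prod ?w t = \<nu>" for t
    using child_prod_comp[OF w id_in_W, of t] pm[of "?w t"]
    by (auto simp: level_sign_inv[OF e(1)] e(2) \<chi>_def)
  with w \<nu> show ?thesis by blast
qed

end

section \<open>The Galois action in a balanced labelling\<close>

lemma galois_group_simps:
  assumes "s \<in> galois_group K"
  shows "s (x + y) = s x + s y" "s (x * y) = s x * s y" "s 0 = 0" "s 1 = 1" "s (- x) = - s x"
    "s (x - y) = s x - s y" "s (inverse x) = inverse (s x)" "s (x / y) = s x / s y"
    "s x = s y \<longleftrightarrow> x = y" "c \<in> K \<Longrightarrow> s c = c"
proof -
  have b: "bij s" and a: "s (x + y) = s x + s y" and m: "s (x * y) = s x * s y" for x y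
    using assms by (auto simp: galois_group_def)
  show "s (x + y) = s x + s y" "s (x * y) = s x * s y" by (fact a m)+
  show i: "s x = s y \<longleftrightarrow> x = y" for x y using b by (auto dest: bij_is_inj injD)
  show 0: "s 0 = 0" using a[of 0 0] by (metis add.right_neutral add_left_imp_eq)
  have "s 1 * s 1 = s 1 * 1" using m[of 1 1] by simp
  moreover have "s 1 \<noteq> 0" using i[of 1 0] 0 by simp
  ultimately show 1: "s 1 = 1" by (simp only: mult_cancel_left) simp
  show n: "s (- x) = - s x" for x using a[of x "- x"] 0 by (simp add: eq_neg_iff_add_eq_0 add.commute)
  show "s (x - y) = s x - s y" using a[of x "- y"] n[of y] by simp
  show v: "s (inverse x) = inverse (s x)" for x
    using m[of x "inverse x"] 0 1 i[of x 0] by (cases "x = 0") (auto intro: inverse_unique[symmetric])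
  show "s (x / y) = s x / s y" by (simp add: divide_inverse m v)
  show "c \<in> K \<Longrightarrow> s c = c" using assms by (auto simp: galois_group_def)
qed

context preimage_tree
begin

context
  fixes K :: "'a set" and s :: "'a \<Rightarrow> 'a"
  assumes f_over: "f \<in> ratfuns_over K" and s: "s \<in> galois_group K"
    and base_point: "map_proj_line s x' = x'"
begin

abbreviation "s\<^sub>P \<equiv> map_proj_line s"
abbreviation "s\<^sub>2 \<equiv> map_prod s s"

lemma coeff_fixed [simp]: "s (coeff (fst f) i) = coeff (fst f) i" "s (coeff (snd f) i) = coeff (snd f) i"
  using f_over galois_group_simps(10)[OF s] by (auto simp: ratfuns_over_def polys_over_def)

lemma homog_galois: "homog (s\<^sub>P z) = s\<^sub>2 (homog z)"
  by (cases z) (simp_all add: galois_group_simps[OF s])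

lemma cross_galois: "cross (s\<^sub>2 v) (s\<^sub>2 w) = s (cross v w)"
  by (simp add: cross_def galois_group_simps[OF s])

lemma proj_galois: "proj (s\<^sub>2 v) = s\<^sub>P (proj v)"
  using galois_group_simps(9)[OF s, of _ 0]
  by (simp add: proj_def galois_group_simps[OF s])

lemma F_galois: "F (s\<^sub>2 v) = s\<^sub>2 (F v)"
  by (simp add: homog_map_def quad_form_def galois_group_simps[OF s])

lemma eval_galois: "ratfun_eval f (s\<^sub>P z) = s\<^sub>P (ratfun_eval f z)"
  by (simp add: ratfun_eval_eq homog_galois F_galois proj_galois)

lemma iterate_galois: "(ratfun_eval f ^^ n) (s\<^sub>P z) = s\<^sub>P ((ratfun_eval f ^^ n) z)"
  by (induction n) (simp_all add: eval_galois)

lemma sP_inj: "s\<^sub>P y = s\<^sub>P z \<longleftrightarrow> y = z"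
  using galois_group_simps(9)[OF s] by (cases y; cases z) auto

lemma critical_galois: "ratfun_critical f z \<Longrightarrow> ratfun_critical f (s\<^sub>P z)"
proof -
  have "s 2 = 2" using galois_group_simps(1,4)[OF s] by (metis one_add_one)
  then have "wronskian (s\<^sub>2 v) = s (wronskian v)" for v
    by (simp add: wronskian_def galois_group_simps[OF s])
  then show "ratfun_critical f z \<Longrightarrow> ratfun_critical f (s\<^sub>P z)"
    by (simp add: critical_iff homog_galois galois_group_simps[OF s])
qed

text \<open>The automorphism permutes the two critical points; exchanging them inverts the
  coordinate.\<close>

lemma coord_galois:
  "(\<forall>z. s (coord z) = coord (s\<^sub>P z)) \<or> (\<forall>z. s (coord z) = inverse (coord (s\<^sub>P z)))"
proof -
  have *: "s (coord z) = cross (homog (s\<^sub>P z)) (homog (s\<^sub>P p\<^sub>0)) / cross (homog (s\<^sub>P z)) (homog (s\<^sub>P q\<^sub>0))"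
    for z
    by (simp add: coord_def ratio_def homog_galois cross_galois galois_group_simps[OF s])
  have "s\<^sub>P p\<^sub>0 \<in> {p\<^sub>0, q\<^sub>0}" "s\<^sub>P q\<^sub>0 \<in> {p\<^sub>0, q\<^sub>0}"
    using critical_galois critical by blast+
  moreover have "s\<^sub>P p\<^sub>0 \<noteq> s\<^sub>P q\<^sub>0" using critical_distinct sP_inj by simp
  ultimately consider "s\<^sub>P p\<^sub>0 = p\<^sub>0" "s\<^sub>P q\<^sub>0 = q\<^sub>0" | "s\<^sub>P p\<^sub>0 = q\<^sub>0" "s\<^sub>P q\<^sub>0 = p\<^sub>0" by auto
  then show ?thesis
  proof cases
    case 1
    then show ?thesis using * by (simp add: coord_def ratio_def)
  next
    case 2
    then show ?thesis using * by (simp add: coord_def ratio_def)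
  qed
qed

definition tree_action :: "word \<Rightarrow> word" where
  "tree_action t = inv_into UNIV \<phi> (map_prod id s\<^sub>P (\<phi> t))"

lemma \<phi>_tree_action: "\<phi> (tree_action t) = (length t, s\<^sub>P (pt t))"
proof -
  have "(length t, s\<^sub>P (pt t)) \<in> preimage_tree_vertices f x'"
    using iterate_pt[of t] base_point by (simp add: preimage_tree_vertices_def iterate_galois)
  then have "(length t, s\<^sub>P (pt t)) \<in> range \<phi>" using bij_\<phi> by (auto simp: bij_betw_def)
  then show ?thesis by (simp add: tree_action_def \<phi>_eq[of t] f_inv_into_f)
qed

lemma length_tree_action: "length (tree_action t) = length t"
  and pt_tree_action: "pt (tree_action t) = s\<^sub>P (pt t)"
  using \<phi>_tree_action[of t] \<phi>_eq[of "tree_action t"] by simp_all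

lemma tree_action_in_W: "tree_action \<in> carrier W"
proof (rule carrier_W_I)
  show "length (tree_action t) = length t" for t by (rule length_tree_action)
  show "\<exists>d. tree_action (t @ [c]) = tree_action t @ [d]" for t c
  proof -
    have "preimage_tree_adj f (\<phi> (tree_action t)) (\<phi> (tree_action (t @ [c])))"
      by (simp add: \<phi>_tree_action preimage_tree_adj_def eval_galois eval_pt_snoc)
    then have "word_adj (tree_action t) (tree_action (t @ [c]))" by (simp add: adj_\<phi>)
    moreover have "length (tree_action (t @ [c])) = Suc (length (tree_action t))"
      by (simp add: length_tree_action)
    ultimately show ?thesis by (auto simp: word_adj_def)
  qed
  show "inj tree_action"
  proof (rule injI)
    fix u v assume "tree_action u = tree_action v"
    then show "u = v"
      using \<phi>_tree_action[of u] \<phi>_tree_action[of v] pt_inj[of u v] by (simp add: sP_inj)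
  qed
qed

lemma level_sign_tree_action:
  assumes w: "w \<in> carrier W" and \<nu>: "\<nu> \<noteq> 0" "\<And>t. child_prod w t = \<nu>"
  shows "level_sign r (inv\<^bsub>W\<^esub> w \<circ> tree_action \<circ> w) t = level_sign r (inv\<^bsub>W\<^esub> w \<circ> tree_action \<circ> w) []"
proof -
  define g where "g = inv\<^bsub>W\<^esub> w \<circ> tree_action \<circ> w"
  have g: "g \<in> carrier W"
    unfolding g_def using w tree_action_in_W by (intro comp_in_W W.inv_closed)
  have wg: "w (g t) = tree_action (w t)" for t
    unfolding g_def using W_inv_apply(1)[OF w] by simp
  \<comment> \<open>Taken to be the identity or inversion: both are multiplicative and fix 1 and -1,
    so the two cases can be treated together.\<close>
  obtain e :: "'a \<Rightarrow> 'a" where e: "\<And>z. s (coord z) = e (coord (s\<^sub>P z))"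
    and e_mult: "\<And>x y. e (x * y) = e x * e y" and e_sign: "e 1 = 1" "e (- 1) = - 1"
    using coord_galois
  proof
    assume "\<forall>z. s (coord z) = coord (s\<^sub>P z)"
    then show thesis using that[of "\<lambda>x. x"] by simp
  next
    assume "\<forall>z. s (coord z) = inverse (coord (s\<^sub>P z))"
    then show thesis using that[of inverse] by simp
  qed
  have "s (child_coord w t) = e (child_coord (w \<circ> g) t)" for t
    by (simp add: child_coord_def e wg pt_tree_action)
  then have "s (child_prod w t) = e (child_prod (w \<circ> g) t)" for t
    by (simp add: descendant_prod_hom[of s] descendant_prod_hom[of e] e_mult galois_group_simps[OF s])
  \<comment> \<open>Applying s to the constant product turns it into that of the labelling
    \<open>w \<circ> g\<close>, up to e; only the sign P_r(g, t) could depend on t.\<close>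
  then have key: "s \<nu> = e (of_int (level_sign r g t)) * e \<nu>" for t
    unfolding child_prod_comp[OF g w] \<nu>(2) e_mult .
  have "e \<nu> \<noteq> 0"
    using key[of "[]"] \<nu>(1) galois_group_simps(3,9)[OF s] by (metis mult_zero_right)
  then have "e (of_int (level_sign r g t)) = e (of_int (level_sign r g []))"
    using key[of t] key[of "[]"] by simp
  \<comment> \<open>Needed to recover the integer sign from its image in the field.\<close>
  moreover have "(1::'a) \<noteq> - 1" using two by (metis add.right_inverse one_add_one)
  ultimately show ?thesis
    unfolding g_def[symmetric]
    using level_sign_pm[of r g t] level_sign_pm[of r g "[]"] e_sign by auto
qed

end

end

theorem theorem4p8p10:
  fixes k k' :: "'a::field set"
    and f :: "'a ratfun"
    and p\<^sub>0 q\<^sub>0 x' :: "'a proj_line"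
    and r :: nat
    and \<phi> :: "word \<Rightarrow> nat \<times> 'a proj_line"
  assumes "CHAR('a) \<noteq> 2"
    and "separable_closure_of k"
    and "f \<in> ratfuns_over k" and "ratfun_degree f = 2"
    and "{z. ratfun_critical f z} = {p\<^sub>0, q\<^sub>0}"
    and "infinite (postcritical_orbit f)"
    and "r \<ge> 1" and "(ratfun_eval f ^^ (r + 1)) p\<^sub>0 = (ratfun_eval f ^^ (r + 1)) q\<^sub>0"
    and "\<And>s. 1 \<le> s \<Longrightarrow> s < r \<Longrightarrow>
           (ratfun_eval f ^^ (s + 1)) p\<^sub>0 \<noteq> (ratfun_eval f ^^ (s + 1)) q\<^sub>0"
    and "is_subfield k'" and "k \<subseteq> k'"
    and "x' \<in> proj_points k' - postcritical_orbit f"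
    and "tree_identification f x' \<phi>"
  shows "\<exists>w\<in>carrier W. galois_image k' \<phi> \<subseteq>
           (\<lambda>g. w \<otimes>\<^bsub>W\<^esub> g \<otimes>\<^bsub>W\<^esub> inv\<^bsub>W\<^esub> w) ` G_tilde r"
proof -
  have two: "(2::'a) \<noteq> 0"
  proof
    assume "(2::'a) = 0"
    then have "CHAR('a) dvd 2" using of_nat_eq_0_iff_char_dvd[of 2, where 'a = 'a] by simp
    moreover have "CHAR('a) \<noteq> 1" using of_nat_eq_0_iff_char_dvd[of 1, where 'a = 'a] by auto
    ultimately show False using assms(1) two_is_prime_nat unfolding prime_nat_iff by blast
  qed
  have over: "f \<in> ratfuns_over k'"
    using assms(3,11) by (auto simp: ratfuns_over_def polys_over_def)
  interpret preimage_tree f p\<^sub>0 q\<^sub>0 x' \<phi> r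
    using assms two by unfold_locales (auto simp: ratfuns_over_def)
  obtain w \<nu> where w: "w \<in> carrier W" and \<nu>: "\<nu> \<noteq> 0" "\<And>t. child_prod w t = \<nu>"
    using balanced_labelling by blast
  have "(\<lambda>t. inv_into UNIV \<phi> (map_prod id (map_proj_line s) (\<phi> t)))
      \<in> (\<lambda>g. w \<otimes>\<^bsub>W\<^esub> g \<otimes>\<^bsub>W\<^esub> inv\<^bsub>W\<^esub> w) ` G_tilde r" (is "?g \<in> _")
    if s: "s \<in> galois_group k'" for s
  proof -
    have base: "map_proj_line s x' = x'"
      using assms(12) s by (auto simp: proj_points_def galois_group_def)
    have eq: "tree_action s = ?g" by (simp add: fun_eq_iff tree_action_def[OF over s base])
    have g: "?g \<in> carrier W" using tree_action_in_W[OF over s base] unfolding eq .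
    \<comment> \<open>The Galois action expressed in the balanced labelling w, where its P_r does
      not depend on the vertex.\<close>
    let ?h = "inv\<^bsub>W\<^esub> w \<circ> ?g \<circ> w"
    have "?h \<in> carrier W" using w g by (intro comp_in_W W.inv_closed)
    then have "?h \<in> G_tilde r"
      using level_sign_tree_action[OF over s base w \<nu>] unfolding eq
      by (intro generator_system.in_G_tilde[OF generator_system.intro[OF assms(7)]]) 
    moreover have "w \<otimes>\<^bsub>W\<^esub> ?h \<otimes>\<^bsub>W\<^esub> inv\<^bsub>W\<^esub> w = ?g"
      by (simp add: fun_eq_iff W_inv_apply[OF w])
    ultimately show ?thesis by (metis (no_types, lifting) image_eqI)
  qed
  then show ?thesis using w unfolding galois_image_def by blast
qed

end
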